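(* Assume the Hitting Set Conjecture. Then there is no $\varepsilon>0$ such that for all $c\ge 1$ there is an algorithm that solves in ${\cal O}(n^{2-\varepsilon})$ time all instances $(G,\pi,S)$ of Balanced Vertex for which $G$ is an $n$-vertex graph with at most $cn\log n$ edges, $\pi(v)=1$ for every vertex $v$ of $G$, and $|S|=1$.
   Context: Hitting Set Conjecture: there is no $\varepsilon>0$ such that for all $c\ge 1$ there is an algorithm that, given two lists $A,B$ of $n$ subsets of a universe $U$ of size at most $c\log n$, can decide in ${\cal O}(n^{2-\varepsilon})$ time if there is a set in the first list $A$ that intersects every set in the second list $B$ (a "hitting set"). All graphs are finite, simple, connected, with unit-length edges; $d(u,v)$ is the shortest-path distance. A proper vertex list is a list $S=(s_1,\ldots,s_p)$ of pairwise different vertices; $d(v,S)=\min_i d(v,s_i)$. The (prioritized) Voronoi diagram of $G=(V,E)$ with respect to $S$ is the partition of $V$ into territories $\mathbb{T}(s_1,S),\ldots,\mathbb{T}(s_p,S)$ where $v\in\mathbb{T}(s_i,S)$ if and only if $d(v,s_i)=d(v,S)$ and $d(v,s_j)>d(v,S)$ for every $j$ with $1\le j<i$. For a cost function $\pi:V\to\mathbb{R}_{\ge 0}$, the load of $s_i$ is $\ell_\pi(s_i,S)=\sum_{v\in\mathbb{T}(s_i,S)}\pi(v)$, and $L_\pi(S)=\max_i \ell_\pi(s_i,S)$. For $v\in V\setminus S$, $S+v=(s_1,\ldots,s_p,v)$. Balanced Vertex: given a graph $G=(V,E)$, a cost function $\pi:V\to\mathbb{R}_{\ge 0}$ and a proper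 vertex list $S$, output a vertex $v\in V\setminus S$ such that $L_\pi(S+v)$ is minimized. Running times are worst-case, in the usual unit-cost RAM model. *)

theory Defs
  imports Complex_Main "HOL-Library.Landau_Symbols"
begin

section \<open>Unit-cost random access machines\<close>

text \<open>
  A machine has registers and a memory, both holding natural numbers. A program is a finite list of
  instructions and so uses finitely many registers; the memory is accessed indirectly, through
  addresses held in registers. The machine halts when the program counter leaves the program.
  Jump targets are absolute.
\<close>

datatype binop = Plus | Minus | Times | Div | Mod | And | Or | Xor

fun eval_binop :: "binop \<Rightarrow> nat \<Rightarrow> nat \<Rightarrow> nat" where
  "eval_binop Plus x y = x + y"
| "eval_binop Minus x y = x - y"
| "eval_binop Times x y = x * y"
| "eval_binop Div x y = x div y"
| "eval_binop Mod x y = x mod y"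
| "eval_binop And x y = and x y"
| "eval_binop Or x y = or x y"
| "eval_binop Xor x y = xor x y"

datatype instr =
    Const nat nat
  | Arith binop nat nat nat
  | Load nat nat
  | Store nat nat
  | Jump nat
  | JumpLess nat nat nat

type_synonym program = "instr list"

record config =
  pc :: nat
  reg :: "nat \<Rightarrow> nat"
  mem :: "nat \<Rightarrow> nat"

fun exec :: "instr \<Rightarrow> config \<Rightarrow> config" where
  "exec (Const r k) s = s\<lparr>pc := Suc (pc s), reg := (reg s)(r := k)\<rparr>"
| "exec (Arith f r x y) s =
     s\<lparr>pc := Suc (pc s), reg := (reg s)(r := eval_binop f (reg s x) (reg s y))\<rparr>"
| "exec (Load r x) s = s\<lparr>pc := Suc (pc s), reg := (reg s)(r := mem s (reg s x))\<rparr>"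
| "exec (Store x r) s = s\<lparr>pc := Suc (pc s), mem := (mem s)(reg s x := reg s r)\<rparr>"
| "exec (Jump l) s = s\<lparr>pc := l\<rparr>"
| "exec (JumpLess x y l) s = s\<lparr>pc := (if reg s x < reg s y then l else Suc (pc s))\<rparr>"

definition halted :: "program \<Rightarrow> config \<Rightarrow> bool" where
  "halted p s \<longleftrightarrow> length p \<le> pc s"

definition step :: "program \<Rightarrow> config \<Rightarrow> config" where
  "step p s = (if halted p s then s else exec (p ! pc s) s)"

definition initial :: "nat list \<Rightarrow> config" where
  "initial xs = \<lparr>pc = 0, reg = (\<lambda>_. 0), mem = (\<lambda>a. if a < length xs then xs ! a else 0)\<rparr>"

definition config_at :: "program \<Rightarrow> nat list \<Rightarrow> nat \<Rightarrow> config" where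
  "config_at p xs t = (step p ^^ t) (initial xs)"

definition fits :: "nat \<Rightarrow> config \<Rightarrow> bool" where
  "fits b s \<longleftrightarrow> (\<forall>r. reg s r < b) \<and> (\<forall>a. mem s a < b)"

definition computes :: "program \<Rightarrow> nat \<Rightarrow> nat list \<Rightarrow> nat \<Rightarrow> nat \<Rightarrow> bool" where
  "computes p b xs t out \<longleftrightarrow>
     halted p (config_at p xs t) \<and> reg (config_at p xs t) 0 = out \<and>
     (\<forall>i\<le>t. fits b (config_at p xs i))"

text \<open>
  Every instruction costs one unit, including multiplication and the bitwise operations. As usual
  this is made reasonable by a word size of \<open>O(log n)\<close> bits, where \<open>n\<close> is the size parameter of the
  instance: all numbers that occur in a run have to be smaller than \<open>(n + 2) ^ k\<close>, for some
  constant \<open>k\<close>. \<open>T\<close> bounds the worst-case running time; \<open>g\<close> is its order of growth.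
\<close>

definition solves_in_O ::
  "program \<Rightarrow> 'i set \<Rightarrow> ('i \<Rightarrow> nat) \<Rightarrow> ('i \<Rightarrow> nat list) \<Rightarrow> ('i \<Rightarrow> nat \<Rightarrow> bool) \<Rightarrow>
   (nat \<Rightarrow> real) \<Rightarrow> bool" where
  "solves_in_O p instances size_of encode correct g \<longleftrightarrow>
     (\<exists>k :: nat. \<exists>T :: nat \<Rightarrow> real. T \<in> O(g) \<and>
        (\<forall>I \<in> instances. \<exists>t out.
           real t \<le> T (size_of I) \<and>
           computes p ((size_of I + 2) ^ k) (encode I) t out \<and>
           correct I out))"


section \<open>Hitting Set\<close>

text \<open>The universe is \<open>{..<univ_size I}\<close>.\<close>

record hs_instance =
  univ_size :: nat
  listA :: "nat set list"
  listB :: "nat set list"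

definition hs_size :: "hs_instance \<Rightarrow> nat" where
  "hs_size I = length (listA I)"

definition hs_instances :: "real \<Rightarrow> hs_instance set" where
  "hs_instances c = {I.
     hs_size I \<ge> 1 \<and> length (listB I) = hs_size I \<and>
     (\<forall>X \<in> set (listA I) \<union> set (listB I). X \<subseteq> {..<univ_size I}) \<and>
     real (univ_size I) \<le> c * log 2 (real (hs_size I))}"

definition has_hitting_set :: "hs_instance \<Rightarrow> bool" where
  "has_hitting_set I \<longleftrightarrow> (\<exists>X \<in> set (listA I). \<forall>Y \<in> set (listB I). X \<inter> Y \<noteq> {})"

definition char_vector :: "nat \<Rightarrow> nat set \<Rightarrow> nat list" where
  "char_vector d X = map (\<lambda>u. if u \<in> X then 1 else 0) [0..<d]"

definition hs_encode :: "hs_instance \<Rightarrow> nat list" where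
  "hs_encode I = [hs_size I, univ_size I] @
     concat (map (char_vector (univ_size I)) (listA I)) @
     concat (map (char_vector (univ_size I)) (listB I))"

definition hs_correct :: "hs_instance \<Rightarrow> nat \<Rightarrow> bool" where
  "hs_correct I out \<longleftrightarrow> out = (if has_hitting_set I then 1 else 0)"

definition Hitting_Set_Conjecture :: bool where
  "Hitting_Set_Conjecture \<longleftrightarrow>
     \<not> (\<exists>\<epsilon>::real. \<epsilon> > 0 \<and> (\<forall>c::real. c \<ge> 1 \<longrightarrow>
          (\<exists>p. solves_in_O p (hs_instances c) hs_size hs_encode hs_correct
                 (\<lambda>n. real n powr (2 - \<epsilon>)))))"


section \<open>Graphs and Voronoi diagrams\<close>

text \<open>A graph is given by its vertex set and its set of edges, which are two-element vertex sets.\<close>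

definition simple_graph :: "'a set \<Rightarrow> 'a set set \<Rightarrow> bool" where
  "simple_graph V E \<longleftrightarrow> finite V \<and> E \<subseteq> {{u, v} |u v. u \<in> V \<and> v \<in> V \<and> u \<noteq> v}"

definition adj :: "'a set set \<Rightarrow> ('a \<times> 'a) set" where
  "adj E = {(u, v). {u, v} \<in> E}"

definition connected_graph :: "'a set \<Rightarrow> 'a set set \<Rightarrow> bool" where
  "connected_graph V E \<longleftrightarrow> V \<noteq> {} \<and> (\<forall>u\<in>V. \<forall>v\<in>V. (u, v) \<in> (adj E)\<^sup>*)"

text \<open>\<open>(u, v) \<in> adj E ^^ k\<close> says that there is a walk with \<open>k\<close> edges from \<open>u\<close> to \<open>v\<close>.\<close>

definition gdist :: "'a set set \<Rightarrow> 'a \<Rightarrow> 'a \<Rightarrow> nat" where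
  "gdist E u v = (LEAST k. (u, v) \<in> adj E ^^ k)"

definition proper_vertex_list :: "'a set \<Rightarrow> 'a list \<Rightarrow> bool" where
  "proper_vertex_list V S \<longleftrightarrow> S \<noteq> [] \<and> distinct S \<and> set S \<subseteq> V"

definition gdist_list :: "'a set set \<Rightarrow> 'a \<Rightarrow> 'a list \<Rightarrow> nat" where
  "gdist_list E v S = Min (gdist E v ` set S)"

definition territory :: "'a set \<Rightarrow> 'a set set \<Rightarrow> 'a list \<Rightarrow> nat \<Rightarrow> 'a set" where
  "territory V E S i =
     {v \<in> V. gdist E v (S ! i) = gdist_list E v S \<and> (\<forall>j<i. gdist E v (S ! j) > gdist_list E v S)}"

definition load :: "'a set \<Rightarrow> 'a set set \<Rightarrow> ('a \<Rightarrow> real) \<Rightarrow> 'a list \<Rightarrow> nat \<Rightarrow> real" where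
  "load V E \<pi> S i = (\<Sum>v \<in> territory V E S i. \<pi> v)"

definition max_load :: "'a set \<Rightarrow> 'a set set \<Rightarrow> ('a \<Rightarrow> real) \<Rightarrow> 'a list \<Rightarrow> real" where
  "max_load V E \<pi> S = Max (load V E \<pi> S ` {..<length S})"

definition balanced_vertex :: "'a set \<Rightarrow> 'a set set \<Rightarrow> ('a \<Rightarrow> real) \<Rightarrow> 'a list \<Rightarrow> 'a \<Rightarrow> bool" where
  "balanced_vertex V E \<pi> S v \<longleftrightarrow>
     v \<in> V - set S \<and> (\<forall>u \<in> V - set S. max_load V E \<pi> (S @ [v]) \<le> max_load V E \<pi> (S @ [u]))"


section \<open>Balanced Vertex\<close>

text \<open>
  The vertices are \<open>0, \<dots>, n - 1\<close>. The graph is given by the list of its edges, each of them listed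
  once, in arbitrary order and orientation.
\<close>

record bv_instance =
  num_vertices :: nat
  edge_list :: "(nat \<times> nat) list"
  cost :: "nat \<Rightarrow> real"
  sites :: "nat list"

definition bv_vertices :: "bv_instance \<Rightarrow> nat set" where
  "bv_vertices I = {..<num_vertices I}"

definition bv_edges :: "bv_instance \<Rightarrow> nat set set" where
  "bv_edges I = (\<lambda>(u, v). {u, v}) ` set (edge_list I)"

text \<open>The last condition excludes the case that there is no vertex that can be added to \<open>S\<close>.\<close>

definition bv_instances :: "bv_instance set" where
  "bv_instances = {I.
     distinct (map (\<lambda>(u, v). {u, v}) (edge_list I)) \<and>
     simple_graph (bv_vertices I) (bv_edges I) \<and>
     connected_graph (bv_vertices I) (bv_edges I) \<and>
     (\<forall>v \<in> bv_vertices I. cost I v \<ge> 0) \<and>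
     proper_vertex_list (bv_vertices I) (sites I) \<and>
     bv_vertices I - set (sites I) \<noteq> {}}"

definition sparse_unit_bv_instances :: "real \<Rightarrow> bv_instance set" where
  "sparse_unit_bv_instances c = {I \<in> bv_instances.
     real (card (bv_edges I)) \<le> c * real (num_vertices I) * log 2 (real (num_vertices I)) \<and>
     (\<forall>v \<in> bv_vertices I. cost I v = 1) \<and>
     length (sites I) = 1}"

text \<open>Costs are written as words; this is faithful for integral costs, in particular unit costs.\<close>

definition bv_encode :: "bv_instance \<Rightarrow> nat list" where
  "bv_encode I = [num_vertices I, length (edge_list I), length (sites I)] @
     concat (map (\<lambda>(u, v). [u, v]) (edge_list I)) @
     map (\<lambda>v. nat \<lfloor>cost I v\<rfloor>) [0..<num_vertices I] @
     sites I"

definition bv_correct :: "bv_instance \<Rightarrow> nat \<Rightarrow> bool" where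
  "bv_correct I out \<longleftrightarrow> balanced_vertex (bv_vertices I) (bv_edges I) (cost I) (sites I) out"

end

theory Submission
  imports Defs
begin

text \<open>
  Let \<open>A\<close>, \<open>B\<close> be lists of \<open>n\<close> subsets of \<open>{..<d}\<close>, and put \<open>D = d + 1\<close>. The graph is layered by
  the distance from the only site \<open>s\<close>: level 1 holds the sets of \<open>A\<close> and \<open>3 D\<close> spokes, level 2 the ends
  of the spokes, which are three copies of \<open>{..d}\<close>, and level 3 the sets of \<open>B\<close>. A set of \<open>A\<close> is joined
  to its elements in the first copy and to its non-elements in the second copy, a set of \<open>B\<close> to its
  elements in the first copy and to its non-elements in the third copy. The extra element \<open>d\<close> is put into
  all sets of \<open>A\<close> and into no set of \<open>B\<close>. Adding a vertex \<open>v\<close> to the list \<open>[s]\<close>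
  gives it the vertices that are closer to \<open>v\<close> than to \<open>s\<close>. For a set of \<open>A\<close> these are itself, its \<open>D\<close>
  neighbours on level 2, and the sets of \<open>B\<close> that it hits; so a hitting set gets \<open>n + d + 2\<close> vertices,
  at most half of the graph. A vertex that is not a hitting set gets fewer, hence if a hitting set exists then each
  balanced vertex is one, and it suffices to test the balanced vertex that was found.

  The graph has \<open>O(n)\<close> vertices and \<open>O(n log n)\<close> edges. A machine for Hitting Set writes the encoding of the
  graph behind its own input, runs the given program for Balanced Vertex on it with all memory
  addresses shifted by the length of the input, and then tests the answer against the untouched input.
\<close>

section \<open>Runs of the machine\<close>

text \<open>The word bound is required of every configuration on the way, both ends included,
  because \<open>computes\<close> requires it; in this form consecutive phases can be
  concatenated.\<close>

definition run :: "program \<Rightarrow> nat \<Rightarrow> config \<Rightarrow> nat \<Rightarrow> config \<Rightarrow> bool" where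
  "run p b s t s' \<longleftrightarrow> (step p ^^ t) s = s' \<and> (\<forall>i\<le>t. fits b ((step p ^^ i) s))"

lemma run_refl: "fits b s \<Longrightarrow> run p b s 0 s"
  by (simp add: run_def)

lemma run_trans:
  assumes "run p b s t s'" "run p b s' t' s''"
  shows "run p b s (t + t') s''"
proof -
  have split: "(step p ^^ (t + j)) s = (step p ^^ j) s'" for j
    using assms(1) by (simp add: run_def add.commute[of t] funpow_add)
  have "fits b ((step p ^^ i) s)" if "i \<le> t + t'" for i
  proof (cases "i \<le> t")
    case True
    then show ?thesis using assms(1) by (simp add: run_def)
  next
    case False
    then obtain j where j: "i = t + j" using le_Suc_ex nat_le_linear by blast
    then show ?thesis using that assms(2) by (simp add: split run_def)
  qed
  then show ?thesis using split[of t'] assms(2) by (simp add: run_def)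
qed

lemma run_step:
  assumes "fits b s" "fits b (step p s)"
  shows "run p b s 1 (step p s)"
  using assms by (auto simp: run_def le_Suc_eq)

lemma run_fits: "run p b s t s' \<Longrightarrow> fits b s'"
  by (auto simp: run_def)

fun code_at :: "program \<Rightarrow> nat \<Rightarrow> instr list \<Rightarrow> bool" where
  "code_at p l [] \<longleftrightarrow> True"
| "code_at p l (i # is) \<longleftrightarrow> l < length p \<and> p ! l = i \<and> code_at p (Suc l) is"

lemma code_at_append:
  "code_at p l (xs @ ys) \<longleftrightarrow> code_at p l xs \<and> code_at p (l + length xs) ys"
  by (induction xs arbitrary: l) auto

lemma code_at_embed: "code_at (us @ xs @ vs) (length us) xs"
proof (induction xs arbitrary: us)
  case (Cons x xs)
  then show ?case using Cons[of "us @ [x]"] by simp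
qed simp

lemma code_at_nth: "code_at p l xs \<Longrightarrow> i < length xs \<Longrightarrow> l + i < length p \<and> p ! (l + i) = xs ! i"
proof (induction xs arbitrary: l i)
  case (Cons x xs)
  show ?case
  proof (cases i)
    case 0
    then show ?thesis using Cons.prems by simp
  next
    case (Suc j)
    then show ?thesis using Cons.IH[of "Suc l" j] Cons.prems by simp
  qed
qed simp

section \<open>Structured programs and their Hoare logic\<close>

datatype com = Block "instr list" | Seq com com (infixr ";;" 60) | Loop nat nat com

fun clen :: "com \<Rightarrow> nat" where
  "clen (Block is) = length is"
| "clen (c ;; c') = clen c + clen c'"
| "clen (Loop x y c) = clen c + 3"

text \<open>Jump targets are absolute, so the compiler needs the address \<open>l\<close> at which
  its output is placed. In a loop the conditional jump skips the exit jump.\<close>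

fun compile :: "nat \<Rightarrow> com \<Rightarrow> program" where
  "compile l (Block is) = is"
| "compile l (c ;; c') = compile l c @ compile (l + clen c) c'"
| "compile l (Loop x y c) =
     [JumpLess x y (l + 2), Jump (l + 3 + clen c)] @ compile (l + 2) c @ [Jump l]"

lemma length_compile [simp]: "length (compile l c) = clen c"
  by (induction c arbitrary: l) auto

type_synonym assn = "(nat \<Rightarrow> nat) \<Rightarrow> (nat \<Rightarrow> nat) \<Rightarrow> bool"

text \<open>Only \<open>Const\<close> and \<open>Arith\<close> can create a number, so only they
  carry a word-bound condition. Jumps get \<open>False\<close>: blocks are straight-line
  code.\<close>

fun wp :: "nat \<Rightarrow> instr list \<Rightarrow> assn \<Rightarrow> assn" where
  "wp b [] Q R M \<longleftrightarrow> Q R M"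
| "wp b (Const r k # is) Q R M \<longleftrightarrow> k < b \<and> wp b is Q (R(r := k)) M"
| "wp b (Arith f r x y # is) Q R M \<longleftrightarrow>
     eval_binop f (R x) (R y) < b \<and> wp b is Q (R(r := eval_binop f (R x) (R y))) M"
| "wp b (Load r x # is) Q R M \<longleftrightarrow> wp b is Q (R(r := M (R x))) M"
| "wp b (Store x r # is) Q R M \<longleftrightarrow> wp b is Q R (M(R x := R r))"
| "wp b (Jump l # is) Q R M \<longleftrightarrow> False"
| "wp b (JumpLess x y l # is) Q R M \<longleftrightarrow> False"

text \<open>Total correctness with time bound \<open>T\<close> and word bound \<open>b\<close>, at
  every address of every surrounding program; control must leave the fragment just behind its
  end.\<close>

definition triple :: "nat \<Rightarrow> assn \<Rightarrow> com \<Rightarrow> nat \<Rightarrow> assn \<Rightarrow> bool" where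
  "triple b P c T Q \<longleftrightarrow>
     (\<forall>p l s. code_at p l (compile l c) \<longrightarrow> pc s = l \<longrightarrow> fits b s \<longrightarrow> P (reg s) (mem s) \<longrightarrow>
        (\<exists>t s'. t \<le> T \<and> run p b s t s' \<and> pc s' = l + clen c \<and> Q (reg s') (mem s')))"

lemma run_block:
  assumes "wp b is Q (reg s) (mem s)" "code_at p (pc s) is" "fits b s"
  shows "\<exists>s'. run p b s (length is) s' \<and> pc s' = pc s + length is \<and> Q (reg s') (mem s')"
  using assms
proof (induction "is" arbitrary: s)
  case Nil
  then show ?case using run_refl by force
next
  case (Cons i "is")
  let ?s = "exec i s"
  have st: "step p s = ?s"
    using Cons.prems(2) by (simp add: step_def halted_def)
  have *: "fits b ?s \<and> wp b is Q (reg ?s) (mem ?s) \<and> pc ?s = Suc (pc s)"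
    using Cons.prems(1,3) by (cases i) (auto simp: fits_def)
  then obtain s' where s': "run p b ?s (length is) s'" "pc s' = pc ?s + length is"
      "Q (reg s') (mem s')"
    using Cons.IH[of ?s] Cons.prems(2) by auto
  have "run p b s (1 + length is) s'"
    using run_trans[OF run_step] st * s'(1) Cons.prems(3) by metis
  then show ?case using s' * by auto
qed

lemma triple_Block:
  assumes "\<And>R M. P R M \<Longrightarrow> wp b is Q R M" "length is \<le> T"
  shows "triple b P (Block is) T Q"
  unfolding triple_def
proof (intro allI impI)
  fix p l s
  assume *: "code_at p l (compile l (Block is))" "pc s = l" "fits b s" "P (reg s) (mem s)"
  obtain s' where "run p b s (length is) s'" "pc s' = l + length is" "Q (reg s') (mem s')"
    using run_block[OF assms(1)[OF *(4)], of p] * by auto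
  then show "\<exists>t s'. t \<le> T \<and> run p b s t s' \<and> pc s' = l + clen (Block is) \<and> Q (reg s') (mem s')"
    using assms(2) by (intro exI[of _ "length is"] exI[of _ s']) simp
qed

lemma triple_Seq:
  assumes "triple b P c T Q" "triple b Q c' T' Q'"
  shows "triple b P (c ;; c') (T + T') Q'"
  unfolding triple_def
proof (intro allI impI)
  fix p l s
  assume code: "code_at p l (compile l (c ;; c'))" and "pc s = l" "fits b s" "P (reg s) (mem s)"
  moreover have c1: "code_at p l (compile l c)" and c2: "code_at p (l + clen c) (compile (l + clen c) c')"
    using code by (auto simp: code_at_append)
  ultimately obtain t s' where 1: "t \<le> T" "run p b s t s'" "pc s' = l + clen c" "Q (reg s') (mem s')"
    using assms(1) unfolding triple_def by blast
  then obtain t' s'' where 2: "t' \<le> T'" "run p b s' t' s''" "pc s'' = l + clen c + clen c'"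
      "Q' (reg s'') (mem s'')"
    using assms(2) c2 run_fits[OF 1(2)] unfolding triple_def by blast
  show "\<exists>t s'. t \<le> T + T' \<and> run p b s t s' \<and> pc s' = l + clen (c ;; c') \<and> Q' (reg s') (mem s')"
    using run_trans[OF 1(2) 2(2)] 1(1) 2 by (intro exI[of _ "t + t'"] exI[of _ s'']) auto
qed

lemma triple_conseq:
  assumes "triple b P c T Q" "\<And>R M. P' R M \<Longrightarrow> P R M" "T \<le> T'" "\<And>R M. Q R M \<Longrightarrow> Q' R M"
  shows "triple b P' c T' Q'"
  unfolding triple_def
proof (intro allI impI)
  fix p l s
  assume "code_at p l (compile l c)" "pc s = l" "fits b s" "P' (reg s) (mem s)"
  then obtain t s' where "t \<le> T" "run p b s t s'" "pc s' = l + clen c" "Q (reg s') (mem s')"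
    using assms(1,2) unfolding triple_def by blast
  then show "\<exists>t s'. t \<le> T' \<and> run p b s t s' \<and> pc s' = l + clen c \<and> Q' (reg s') (mem s')"
    using assms(3,4) le_trans by blast
qed

text \<open>Each round costs two steps besides the body, for the test and the jump back; the failing
  test and the exit jump give the final 2.\<close>

lemma triple_Loop:
  assumes body: "\<And>i. i < m \<Longrightarrow> triple b (I i) c T (I (Suc i))"
    and guard: "\<And>i R M. i \<le> m \<Longrightarrow> I i R M \<Longrightarrow> (R x < R y \<longleftrightarrow> i < m)"
  shows "triple b (I 0) (Loop x y c) (m * (T + 2) + 2) (I m)"
  unfolding triple_def
proof (intro allI impI)
  fix p l s
  assume code: "code_at p l (compile l (Loop x y c))" and s: "pc s = l" "fits b s" "I 0 (reg s) (mem s)"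
  have code': "l < length p" "p ! l = JumpLess x y (l + 2)" "Suc l < length p"
    "p ! (Suc l) = Jump (l + 3 + clen c)" "code_at p (l + 2) (compile (l + 2) c)"
    "l + 2 + clen c < length p" "p ! (l + 2 + clen c) = Jump l"
    using code by (auto simp: code_at_append add.commute)
  \<comment> \<open>Induction on the number \<open>k\<close> of rounds that are still to
    come.\<close>
  have "\<exists>t s'. t \<le> k * (T + 2) + 2 \<and> run p b s t s' \<and> pc s' = l + clen (Loop x y c) \<and>
      I m (reg s') (mem s')"
    if "k \<le> m" "pc s = l" "fits b s" "I (m - k) (reg s) (mem s)" for k s
    using that
  proof (induction k arbitrary: s)
    case 0
    let ?s1 = "s\<lparr>pc := Suc l\<rparr>" and ?s2 = "s\<lparr>pc := l + 3 + clen c\<rparr>"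
    have f: "fits b ?s1" "fits b ?s2" using 0 by (auto simp: fits_def)
    have "step p s = ?s1" "step p ?s1 = ?s2"
      using 0 code' guard[of m "reg s" "mem s"] by (auto simp: step_def halted_def)
    then have "run p b s (1 + 1) ?s2"
      using f run_trans[OF run_step run_step] 0 by metis
    then show ?case using 0 by (intro exI[of _ 2] exI[of _ ?s2]) (auto simp: numeral_2_eq_2)
  next
    case (Suc k)
    let ?i = "m - Suc k" and ?s1 = "s\<lparr>pc := l + 2\<rparr>"
    have i: "?i < m" "Suc ?i = m - k" using Suc.prems by auto
    have f: "fits b ?s1" using Suc.prems by (auto simp: fits_def)
    have "step p s = ?s1"
      using Suc.prems code' i guard[of ?i "reg s" "mem s"] by (auto simp: step_def halted_def)
    then have r1: "run p b s 1 ?s1"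
      using f run_step Suc.prems by metis
    have "I ?i (reg ?s1) (mem ?s1)" "pc ?s1 = l + 2" using Suc.prems by auto
    then obtain t s2 where 2: "t \<le> T" "run p b ?s1 t s2" "pc s2 = l + 2 + clen c"
        "I (m - k) (reg s2) (mem s2)"
      using body[OF i(1)] f code'(5) unfolding triple_def i(2) by blast
    let ?s3 = "s2\<lparr>pc := l\<rparr>"
    have f2: "fits b s2" "fits b ?s3" using run_fits[OF 2(2)] by (auto simp: fits_def)
    have "step p s2 = ?s3"
      using 2 code' by (auto simp: step_def halted_def)
    then have r3: "run p b s2 1 ?s3"
      using f2 run_step by metis
    obtain t' s4 where 4: "t' \<le> k * (T + 2) + 2" "run p b ?s3 t' s4"
        "pc s4 = l + clen (Loop x y c)" "I m (reg s4) (mem s4)"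
      using Suc.IH[of ?s3] Suc.prems(1) f2 2 by auto
    have "run p b s (1 + (t + (1 + t'))) s4"
      using r1 2(2) r3 4(2) by (meson run_trans)
    then show ?case using 4 2(1) by (intro exI[of _ "1 + (t + (1 + t'))"] exI[of _ s4]) auto
  qed
  from this[of m s] s show "\<exists>t s'. t \<le> m * (T + 2) + 2 \<and> run p b s t s' \<and>
      pc s' = l + clen (Loop x y c) \<and> I m (reg s') (mem s')" by simp
qed

section \<open>Running a program as a subroutine\<close>

text \<open>
  Register \<open>r\<close> of the subroutine is kept in register \<open>reloc + r\<close>, and memory cell \<open>a\<close> in cell \<open>L + a\<close>.
  Each of its instructions becomes exactly two, so that jump targets can be computed.
\<close>

definition reloc :: nat where "reloc = 20"
definition addr_reg :: nat where "addr_reg = 16"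
definition offset_reg :: nat where "offset_reg = 17"

text \<open>Targets beyond the end are clipped to \<open>m\<close>, the length of the subroutine:
  wherever it jumps to in order to halt, control arrives just behind the translated code.\<close>

fun sim_instr :: "nat \<Rightarrow> nat \<Rightarrow> instr \<Rightarrow> program" where
  "sim_instr l m (Const r k) = [Const addr_reg 0, Const (reloc + r) k]"
| "sim_instr l m (Arith f r x y) = [Const addr_reg 0, Arith f (reloc + r) (reloc + x) (reloc + y)]"
| "sim_instr l m (Load r x) = [Arith Plus addr_reg (reloc + x) offset_reg, Load (reloc + r) addr_reg]"
| "sim_instr l m (Store x r) = [Arith Plus addr_reg (reloc + x) offset_reg, Store addr_reg (reloc + r)]"
| "sim_instr l m (Jump j) = [Const addr_reg 0, Jump (l + 2 * min j m)]"
| "sim_instr l m (JumpLess x y j) =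
     [Const addr_reg 0, JumpLess (reloc + x) (reloc + y) (l + 2 * min j m)]"

definition sim :: "nat \<Rightarrow> program \<Rightarrow> program" where
  "sim l p = concat (map (sim_instr l (length p)) p)"

text \<open>\<open>addr_reg\<close> is scratch space for shifted addresses, hence exempt from the
  registers that keep their value in \<open>R\<close>. The minimum identifies all halting program
  counters.\<close>

definition simulates :: "nat \<Rightarrow> nat \<Rightarrow> nat \<Rightarrow> (nat \<Rightarrow> nat) \<Rightarrow> (nat \<Rightarrow> nat) \<Rightarrow> config \<Rightarrow> config \<Rightarrow> bool" where
  "simulates l m L R M s s' \<longleftrightarrow>
     pc s' = l + 2 * min (pc s) m \<and> (\<forall>r. reg s' (reloc + r) = reg s r) \<and>
     (\<forall>r<reloc. r \<noteq> addr_reg \<longrightarrow> reg s' r = R r) \<and>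
     (\<forall>a. mem s' (L + a) = mem s a) \<and> (\<forall>a<L. mem s' a = M a)"

lemma length_sim_instr [simp]: "length (sim_instr l m i) = 2"
  by (cases i) auto

lemma length_sim [simp]: "length (sim l p) = 2 * length p"
proof -
  have "length (concat (map (sim_instr l m) p)) = 2 * length p" for m
    by (induction p) auto
  then show ?thesis by (simp add: sim_def)
qed

lemma code_at_sim:
  assumes "code_at q l (sim l p)" "i < length p"
  shows "code_at q (l + 2 * i) (sim_instr l (length p) (p ! i))"
proof -
  have "code_at q (k + 2 * i) (sim_instr l m (p ! i))"
    if "code_at q k (concat (map (sim_instr l m) p))" "i < length p" for k m
    using that
  proof (induction p arbitrary: k i)
    case (Cons x p)
    show ?case
    proof (cases i)
      case 0
      then show ?thesis using Cons.prems by (simp add: code_at_append)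
    next
      case (Suc j)
      then show ?thesis
        using Cons.IH[of "k + 2" j] Cons.prems by (simp add: code_at_append)
    qed
  qed simp
  then show ?thesis using assms by (simp add: sim_def)
qed

text \<open>The simulation adds shifted addresses to the numbers of the subroutine; these stay below
  \<open>b + L\<close>, so the word bound has to grow only by \<open>L\<close>.\<close>

lemma sim_step:
  assumes rel: "simulates l (length p) L R M s s'" and nh: "\<not> halted p s"
    and code: "code_at q l (sim l p)" and off: "R offset_reg = L"
    and fit: "fits b s" "fits b (step p s)" "fits b' s'" and b': "b + L \<le> b'"
  shows "\<exists>s''. run q b' s' 2 s'' \<and> simulates l (length p) L R M (step p s) s''"
proof -
  let ?i = "p ! pc s"
  let ?m = "length p"
  have pc: "pc s < ?m" using nh by (simp add: halted_def)
  have pc': "pc s' = l + 2 * pc s" using rel pc by (simp add: simulates_def)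
  have c: "code_at q (pc s') (sim_instr l ?m ?i)"
    using code_at_sim[OF code pc] pc' by simp
  have code1: "pc s' < length q" "q ! pc s' = sim_instr l ?m ?i ! 0"
    and code2: "Suc (pc s') < length q" "q ! Suc (pc s') = sim_instr l ?m ?i ! 1"
    using code_at_nth[OF c, of 0] code_at_nth[OF c, of 1] by auto
  define s1 where "s1 = exec (sim_instr l ?m ?i ! 0) s'"
  define s2 where "s2 = exec (sim_instr l ?m ?i ! 1) s1"
  have st: "step p s = exec ?i s" using nh by (simp add: step_def)
  have regs: "reg s' (reloc + r) = reg s r" for r using rel by (simp add: simulates_def)
  have ne: "reloc + r \<noteq> addr_reg" "addr_reg \<noteq> reloc + r" for r by (simp_all add: reloc_def addr_reg_def)
  have offs: "reg s' offset_reg = L"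
    using rel off by (simp add: simulates_def reloc_def addr_reg_def offset_reg_def)
  have b0: "0 < b" using fit(1) by (auto simp: fits_def)
  have lt: "reg s r < b" "mem s a < b" for r a using fit(1) by (auto simp: fits_def)
  have lt': "reg s' r < b'" "mem s' a < b'" for r a using fit(3) by (auto simp: fits_def)
  have addlt: "reg s r + L < b'" for r using lt(1)[of r] b' by linarith
  have pc1: "pc s1 = Suc (pc s')" unfolding s1_def by (cases ?i) auto
  have step1: "step q s' = s1" using code1 by (simp add: step_def halted_def s1_def)
  have step2: "step q s1 = s2" using code2 pc1 by (simp add: step_def halted_def s2_def)
  have f1: "fits b' s1"
    using lt' b0 b' addlt unfolding s1_def
    by (cases ?i) (auto simp: fits_def regs offs)
  have ltn: "reg (exec ?i s) r < b" "mem (exec ?i s) a < b" for r a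
    using fit(2) by (auto simp: fits_def st)
  have wl: "reg (exec ?i s) r < b'" "mem (exec ?i s) a < b'" for r a
    using ltn(1)[of r] ltn(2)[of a] b' by linarith+
  \<comment> \<open>The bound on the newly written value is read off the original configuration
    after the step, where a register holds that value.\<close>
  have "k < b'" if "?i = Const r k" for r k
    using wl(1)[of r] that by simp
  moreover have "eval_binop f (reg s x) (reg s y) < b'" if "?i = Arith f r x y" for f r x y
    using wl(1)[of r] that by simp
  ultimately have f2: "fits b' s2"
    using lt' b0 b' wl addlt less_le_trans[OF lt(1)] unfolding s2_def s1_def
    by (cases ?i) (auto simp: fits_def regs offs ne split: if_splits)
  have "simulates l ?m L R M (step p s) s2"
    using rel pc unfolding st s2_def s1_def
    by (cases ?i) (auto simp: simulates_def ne regs offs add.commute min_def reloc_def addr_reg_def)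
  moreover have "run q b' s' (1 + 1) s2"
    using run_trans[OF run_step run_step] step1 step2 f1 f2 fit(3) by metis
  ultimately show ?thesis by (auto simp: numeral_2_eq_2)
qed


lemma sim_run:
  assumes comp: "computes p b xs t out"
    and code: "code_at q l (sim l p)" and off: "R offset_reg = L"
    and rel: "simulates l (length p) L R M (initial xs) s" and fit: "fits b' s" and b': "b + L \<le> b'"
  shows "\<exists>t' s'. t' \<le> 2 * t \<and> run q b' s t' s' \<and> pc s' = l + 2 * length p \<and> reg s' reloc = out \<and>
    (\<forall>r<reloc. r \<noteq> addr_reg \<longrightarrow> reg s' r = R r) \<and> (\<forall>a<L. mem s' a = M a)"
proof -
  have fits: "fits b (config_at p xs i)" if "i \<le> t" for i
    using comp that by (simp add: computes_def)
  have "\<exists>t' s'. t' \<le> 2 * i \<and> run q b' s t' s' \<and> simulates l (length p) L R M (config_at p xs i) s'"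
    if "i \<le> t" for i
    using that
  proof (induction i)
    case 0
    then show ?case using rel run_refl[OF fit] by (auto simp: config_at_def)
  next
    case (Suc i)
    then obtain t' s' where *: "t' \<le> 2 * i" "run q b' s t' s'"
        "simulates l (length p) L R M (config_at p xs i) s'" by auto
    have next_config: "config_at p xs (Suc i) = step p (config_at p xs i)"
      by (simp add: config_at_def)
    show ?case
    proof (cases "halted p (config_at p xs i)")
      \<comment> \<open>A halted configuration is a fixed point of \<open>step\<close>, so the
        simulation does not move either; this is why the time is only bounded by
        \<open>2 * t\<close>.\<close>
      case True
      then have "config_at p xs (Suc i) = config_at p xs i"
        by (simp add: next_config step_def)
      then show ?thesis using * by (intro exI[of _ t'] exI[of _ s']) auto
    next
      case False
      then obtain s'' where "run q b' s' 2 s''"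
          "simulates l (length p) L R M (config_at p xs (Suc i)) s''"
        using sim_step[OF *(3) False code off fits _ run_fits[OF *(2)] b'] fits[OF Suc.prems]
          Suc.prems unfolding next_config by auto
      moreover from this(1) have "run q b' s (t' + 2) s''" by (rule run_trans[OF *(2)])
      moreover have "t' + 2 \<le> 2 * Suc i" using *(1) by simp
      ultimately show ?thesis by blast
    qed
  qed
  from this[OF order_refl] obtain t' s' where *: "t' \<le> 2 * t" "run q b' s t' s'"
      "simulates l (length p) L R M (config_at p xs t) s'" by blast
  moreover have "length p \<le> pc (config_at p xs t)" "reg (config_at p xs t) 0 = out"
    using comp by (auto simp: computes_def halted_def)
  moreover have "reg s' reloc = reg (config_at p xs t) 0"
    using *(3) unfolding simulates_def by (metis add_0_right)
  ultimately show ?thesis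
    by (intro exI[of _ t'] exI[of _ s']) (auto simp: simulates_def)
qed

section \<open>The instance of Balanced Vertex\<close>

text \<open>
  The vertices \<open>0, \<dots>, n - 1\<close> are the sets of \<open>A\<close>, \<open>n, \<dots>, 2 n - 1\<close> those of \<open>B\<close>, \<open>2 n\<close> is the site;
  then come the \<open>3 D\<close> spokes, and from \<open>spoke_end n d\<close> on the ends of the spokes.
\<close>

definition spoke_end :: "nat \<Rightarrow> nat \<Rightarrow> nat" where "spoke_end n d = 2 * n + 1 + 3 * Suc d"
definition bv_order :: "nat \<Rightarrow> nat \<Rightarrow> nat" where "bv_order n d = 2 * n + 1 + 6 * Suc d"

definition spokes :: "nat \<Rightarrow> nat \<Rightarrow> nat \<Rightarrow> (nat \<times> nat) list" where
  "spokes n d i = concat (map (\<lambda>i. [(2 * n, 2 * n + 1 + i), (2 * n + 1 + i, spoke_end n d + i)]) [0..<i])"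

definition links :: "nat \<Rightarrow> nat \<Rightarrow> (nat \<times> nat) list" where
  "links n i = map (\<lambda>a. (2 * n, a)) [0..<i]"

text \<open>\<open>k\<close> selects the copy for the non-elements: \<open>Suc d\<close> leads to
  the second, \<open>2 * Suc d\<close> to the third. Elements and non-elements both give an edge, so
  the number of edges depends on \<open>n\<close> and \<open>d\<close> alone and can be written
  before the edges.\<close>

definition row :: "nat \<Rightarrow> nat \<Rightarrow> nat set \<Rightarrow> nat \<Rightarrow> nat \<Rightarrow> (nat \<times> nat) list" where
  "row w k X v m = map (\<lambda>e. (v, w + e + (if e \<in> X then 0 else k))) [0..<m]"

definition rows :: "nat \<Rightarrow> nat \<Rightarrow> nat \<Rightarrow> nat set list \<Rightarrow> nat \<Rightarrow> nat \<Rightarrow> (nat \<times> nat) list" where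
  "rows w k D Xs v i = concat (map (\<lambda>i. row w k (Xs ! i) (v + i) D) [0..<i])"

definition flat :: "(nat \<times> nat) list \<Rightarrow> nat list" where
  "flat es = concat (map (\<lambda>(u, v). [u, v]) es)"

lemma flat_simps [simp]:
  "flat [] = []" "flat ((u, v) # es) = u # v # flat es" "flat (es @ es') = flat es @ flat es'"
  by (simp_all add: flat_def)

lemma length_flat [simp]: "length (flat es) = 2 * length es"
  by (induction es) auto

lemma spokes_simps [simp]:
  "spokes n d 0 = []"
  "spokes n d (Suc i) =
     spokes n d i @ [(2 * n, 2 * n + 1 + i), (2 * n + 1 + i, spoke_end n d + i)]"
  by (simp_all add: spokes_def)

lemma links_simps [simp]: "links n 0 = []" "links n (Suc i) = links n i @ [(2 * n, i)]"
  by (simp_all add: links_def)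

lemma row_simps [simp]:
  "row w k X v 0 = []"
  "row w k X v (Suc e) = row w k X v e @ [(v, w + e + (if e \<in> X then 0 else k))]"
  by (simp_all add: row_def)

lemma rows_simps [simp]:
  "rows w k D Xs v 0 = []"
  "rows w k D Xs v (Suc i) = rows w k D Xs v i @ row w k (Xs ! i) (v + i) D"
  by (simp_all add: rows_def)

lemma length_spokes [simp]: "length (spokes n d i) = 2 * i"
  by (induction i) auto

lemma length_links [simp]: "length (links n i) = i"
  by (induction i) auto

lemma length_row [simp]: "length (row w k X v m) = m"
  by (induction m) auto

lemma length_rows [simp]: "length (rows w k D Xs v i) = i * D"
  by (induction i) auto

section \<open>The program that writes the instance\<close>

definition mem_of :: "nat list \<Rightarrow> nat \<Rightarrow> nat" where
  "mem_of xs = (\<lambda>a. if a < length xs then xs ! a else 0)"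

lemma mem_of_snoc: "p = length xs \<Longrightarrow> (mem_of xs)(p := v) = mem_of (xs @ [v])"
  by (auto simp: mem_of_def nth_append fun_eq_iff)

lemma mem_of_prefix: "a < length xs \<Longrightarrow> mem_of (xs @ ys) a = xs ! a"
  by (simp add: mem_of_def nth_append)

text \<open>Register 6 is the write pointer; register 1 holds the constant 1.\<close>

definition emit :: "nat \<Rightarrow> instr list" where
  "emit r = [Store 6 r, Arith Plus 6 6 1]"

text \<open>Register 17 is \<open>offset_reg\<close> and holds the length of the Hitting Set input.
  Registers from 20 on stay 0 because the subroutine must find its own registers cleared.\<close>

definition env :: "nat \<Rightarrow> nat \<Rightarrow> (nat \<Rightarrow> nat) \<Rightarrow> bool" where
  "env n d R \<longleftrightarrow> R 1 = 1 \<and> R 2 = n \<and> R 3 = d \<and> R 4 = Suc d \<and> R 5 = spoke_end n d \<and> R 12 = 2 * n \<and>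
     R 17 = 2 + 2 * (n * d) \<and> R 18 = bv_order n d \<and> (\<forall>r\<ge>20. R r = 0)"

definition written :: "nat list \<Rightarrow> assn" where
  "written ys R M \<longleftrightarrow> R 6 = length ys \<and> M = mem_of ys"

text \<open>Register 0 is still 0: it serves as the address of \<open>n\<close> and as the zero in
  the copy from register 6 to register 17.\<close>

definition init_code :: com where
  "init_code = Block ([Const 1 1, Load 2 0, Load 3 1, Arith Plus 4 3 1, Arith Times 6 2 3,
     Arith Plus 6 6 6, Arith Plus 6 6 1, Arith Plus 6 6 1, Arith Plus 17 6 0, Arith Plus 12 2 2,
     Arith Plus 5 12 1, Arith Plus 5 5 4, Arith Plus 5 5 4, Arith Plus 5 5 4,
     Arith Plus 18 5 4, Arith Plus 18 18 4, Arith Plus 18 18 4] @ emit 18 @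
     [Arith Times 10 12 4, Arith Plus 10 10 2, Arith Plus 10 10 4, Arith Plus 10 10 4,
      Arith Plus 10 10 4, Arith Plus 10 10 4, Arith Plus 10 10 4, Arith Plus 10 10 4] @
     emit 10 @ emit 1)"

definition spokes_code :: com where
  "spokes_code =
     Block [Const 9 0, Arith Plus 15 4 4, Arith Plus 15 15 4, Arith Plus 8 12 1, Arith Plus 10 5 9] ;;
     Loop 9 15 (Block (emit 12 @ emit 8 @ emit 8 @ emit 10 @
       [Arith Plus 8 8 1, Arith Plus 10 10 1, Arith Plus 9 9 1]))"

definition links_code :: com where
  "links_code = Block [Const 8 0] ;; Loop 8 2 (Block (emit 12 @ emit 8 @ [Arith Plus 8 8 1]))"

text \<open>Register 7 runs through the input bits. Multiplying one minus the bit by the shift in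
  register 13 avoids a branch. The extra element \<open>d\<close> has no bit; its end is the same
  for all sets of a list and is kept in register 14.\<close>

definition rows_code :: com where
  "rows_code = Loop 8 15 (
     Block [Const 9 0] ;;
     Loop 9 3 (Block ([Load 10 7, Arith Minus 10 1 10, Arith Times 10 10 13, Arith Plus 10 10 9,
       Arith Plus 10 10 5] @ emit 8 @ emit 10 @ [Arith Plus 7 7 1, Arith Plus 9 9 1])) ;;
     Block (emit 8 @ emit 14 @ [Arith Plus 8 8 1]))"

definition tail_code :: com where
  "tail_code = Block [Const 9 0] ;; Loop 9 18 (Block (emit 1 @ [Arith Plus 9 9 1])) ;; Block (emit 12)"

text \<open>The second \<open>rows_code\<close> inherits registers 7 and 8 from the first: they have
  reached the first bit of \<open>B\<close> and the vertex \<open>n\<close>, the first set of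
  \<open>B\<close>.\<close>

definition write_code :: com where
  "write_code = init_code ;; spokes_code ;; links_code ;;
     Block [Const 8 0, Const 7 2, Arith Plus 13 4 8, Arith Plus 14 5 3, Arith Plus 15 2 8] ;; rows_code ;;
     Block [Arith Plus 13 4 4, Arith Plus 14 14 13, Arith Plus 15 2 2] ;; rows_code ;; tail_code"

lemma triple_init:
  assumes "length xs = 2 + 2 * (n * d)" "xs ! 0 = n" "xs ! 1 = d"
    and "8 * (n * d) + 20 * n + 20 * d + 100 < b"
  shows "triple b (\<lambda>R M. (\<forall>r. R r = 0) \<and> M = mem_of xs) init_code 31
    (\<lambda>R M. env n d R \<and>
       written (xs @ [bv_order n d, 2 * n * Suc d + n + 6 * Suc d, 1]) R M)"
proof -
  have rd: "mem_of xs 0 = n" "mem_of xs (Suc 0) = d"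
    using assms by (auto simp: mem_of_def)
  have "triple b (\<lambda>R M. (\<forall>r. R r = 0) \<and> M = mem_of xs) init_code 31
    (\<lambda>R M. env n d R \<and>
       written (xs @ [bv_order n d, 2 * n * Suc d + n + 6 * Suc d, 1]) R M)"
    unfolding init_code_def
    by (rule triple_Block)
      (use assms(1,4) rd in \<open>auto simp: env_def written_def emit_def mem_of_snoc bv_order_def spoke_end_def
         algebra_simps intro!: arg_cong[where f = mem_of]\<close>)
  then show ?thesis by (simp add: emit_def)
qed

lemma triple_spokes:
  assumes "length ys + 12 * Suc d + 10 < b" "bv_order n d + 10 < b"
  shows "triple b (\<lambda>R M. env n d R \<and> written ys R M) spokes_code (5 + (3 * Suc d * (11 + 2) + 2))
    (\<lambda>R M. env n d R \<and> written (ys @ flat (spokes n d (3 * Suc d))) R M)"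
proof -
  define I where "I i R M \<longleftrightarrow> env n d R \<and> R 9 = i \<and> R 15 = 3 * Suc d \<and> R 8 = 2 * n + 1 + i \<and>
    R 10 = spoke_end n d + i \<and> written (ys @ flat (spokes n d i)) R M" for i R M
  have body: "triple b (I i) (Block (emit 12 @ emit 8 @ emit 8 @ emit 10 @
       [Arith Plus 8 8 1, Arith Plus 10 10 1, Arith Plus 9 9 1])) 11 (I (Suc i))" if "i < 3 * Suc d" for i
    by (rule triple_Block)
      (use assms that in \<open>auto simp: I_def env_def written_def emit_def mem_of_snoc
         bv_order_def spoke_end_def\<close>)
  have pre: "triple b (\<lambda>R M. env n d R \<and> written ys R M) (Block [Const 9 0, Arith Plus 15 4 4,
      Arith Plus 15 15 4, Arith Plus 8 12 1, Arith Plus 10 5 9]) 5 (I 0)"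
    by (rule triple_Block)
      (use assms in \<open>auto simp: I_def env_def written_def bv_order_def spoke_end_def\<close>)
  have loop: "triple b (I 0) (Loop 9 15 (Block (emit 12 @ emit 8 @ emit 8 @ emit 10 @
       [Arith Plus 8 8 1, Arith Plus 10 10 1, Arith Plus 9 9 1]))) (3 * Suc d * (11 + 2) + 2) (I (3 * Suc d))"
    by (rule triple_Loop[where I = I, OF body]) (auto simp: I_def)
  show ?thesis
    unfolding spokes_code_def
    by (rule triple_conseq[OF triple_Seq[OF pre loop]]) (auto simp: I_def)
qed

lemma triple_links:
  assumes "length ys + 2 * n + 10 < b"
  shows "triple b (\<lambda>R M. env n d R \<and> written ys R M) links_code (1 + (n * (5 + 2) + 2))
    (\<lambda>R M. env n d R \<and> written (ys @ flat (links n n)) R M)"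
proof -
  define I where "I i R M \<longleftrightarrow> env n d R \<and> R 8 = i \<and> written (ys @ flat (links n i)) R M" for i R M
  have body: "triple b (I i) (Block (emit 12 @ emit 8 @ [Arith Plus 8 8 1])) 5 (I (Suc i))"
    if "i < n" for i
    by (rule triple_Block)
      (use assms that in \<open>auto simp: I_def env_def written_def emit_def mem_of_snoc\<close>)
  have pre: "triple b (\<lambda>R M. env n d R \<and> written ys R M) (Block [Const 8 0]) 1 (I 0)"
    by (rule triple_Block)
      (use assms in \<open>auto simp: I_def env_def written_def\<close>)
  have loop: "triple b (I 0) (Loop 8 2 (Block (emit 12 @ emit 8 @ [Arith Plus 8 8 1])))
      (n * (5 + 2) + 2) (I n)"
    by (rule triple_Loop[where I = I, OF body]) (auto simp: I_def env_def)
  show ?thesis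
    unfolding links_code_def
    by (rule triple_conseq[OF triple_Seq[OF pre loop]]) (auto simp: I_def)
qed

lemma triple_tail:
  assumes "length ys + bv_order n d + 10 < b"
  shows "triple b (\<lambda>R M. env n d R \<and> written ys R M) tail_code (1 + ((bv_order n d * (3 + 2) + 2) + 2))
    (\<lambda>R M. env n d R \<and> written (ys @ replicate (bv_order n d) 1 @ [2 * n]) R M)"
proof -
  define I where "I i R M \<longleftrightarrow> env n d R \<and> R 9 = i \<and> written (ys @ replicate i 1) R M" for i R M
  have body: "triple b (I i) (Block (emit 1 @ [Arith Plus 9 9 1])) 3 (I (Suc i))"
    if "i < bv_order n d" for i
    by (rule triple_Block)
      (use assms that in \<open>auto simp: I_def env_def written_def emit_def mem_of_snoc replicate_append_same\<close>)
  have pre: "triple b (\<lambda>R M. env n d R \<and> written ys R M) (Block [Const 9 0]) 1 (I 0)"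
    by (rule triple_Block) (use assms in \<open>auto simp: I_def env_def written_def\<close>)
  have loop: "triple b (I 0) (Loop 9 18 (Block (emit 1 @ [Arith Plus 9 9 1])))
      (bv_order n d * (3 + 2) + 2) (I (bv_order n d))"
    by (rule triple_Loop[where I = I, OF body]) (auto simp: I_def env_def)
  have post: "triple b (I (bv_order n d)) (Block (emit 12)) 2
     (\<lambda>R M. env n d R \<and> written (ys @ replicate (bv_order n d) 1 @ [2 * n]) R M)"
    by (rule triple_Block)
      (use assms in \<open>auto simp: I_def env_def written_def emit_def mem_of_snoc\<close>)
  show ?thesis
    unfolding tail_code_def
    by (rule triple_Seq[OF pre triple_Seq[OF loop post]])
qed

lemma triple_rows:
  assumes data: "\<And>i e. i < m \<Longrightarrow> e < d \<Longrightarrow> q + i * d + e < length ys \<and>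
      ys ! (q + i * d + e) = (if e \<in> Xs ! i then 1 else 0)"
    and last: "\<And>i. i < m \<Longrightarrow> spoke_end n d + d + (if d \<in> Xs ! i then 0 else k) = z"
    and bnd: "length ys + 2 * (m * Suc d) + 10 < b" "v + m + 10 < b" "spoke_end n d + d + k + 10 < b"
      "q + m * d + 10 < b"
  shows "triple b
    (\<lambda>R M. env n d R \<and> R 7 = q \<and> R 8 = v \<and> R 13 = k \<and> R 14 = z \<and> R 15 = v + m \<and> written ys R M)
    rows_code (m * ((1 + ((d * (11 + 2) + 2) + 5)) + 2) + 2)
    (\<lambda>R M. env n d R \<and> R 7 = q + m * d \<and> R 8 = v + m \<and> R 13 = k \<and> R 14 = z \<and>
       written (ys @ flat (rows (spoke_end n d) k (Suc d) Xs v m)) R M)"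
proof -
  let ?w = "spoke_end n d"
  define C where "C R \<longleftrightarrow> env n d R \<and> R 13 = k \<and> R 14 = z \<and> R 15 = v + m" for R
  define I where "I i R M \<longleftrightarrow> C R \<and> R 7 = q + i * d \<and> R 8 = v + i \<and>
    written (ys @ flat (rows ?w k (Suc d) Xs v i)) R M" for i R M
  define J where "J i e R M \<longleftrightarrow> C R \<and> R 7 = q + i * d + e \<and> R 8 = v + i \<and> R 9 = e \<and>
    written (ys @ flat (rows ?w k (Suc d) Xs v i) @ flat (row ?w k (Xs ! i) (v + i) e)) R M" for i e R M
  define inner where "inner = Block ([Load 10 7, Arith Minus 10 1 10, Arith Times 10 10 13, Arith Plus 10 10 9,
       Arith Plus 10 10 5] @ emit 8 @ emit 10 @ [Arith Plus 7 7 1, Arith Plus 9 9 1])"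
  \<comment> \<open>Bounds the read pointer and the length of the partial output in round
    \<open>i\<close> by their final values, which the word bound covers.\<close>
  have le: "i * d + d \<le> m * d" "2 * (i * Suc d) + 2 * Suc d \<le> 2 * (m * Suc d)" if "i < m" for i
    using that mult_le_mono1[of "Suc i" m d] mult_le_mono1[of "Suc i" m "Suc d"]
    by (auto simp: algebra_simps)
  have inner: "triple b (J i e) inner 11 (J i (Suc e))" if "i < m" "e < d" for i e
    unfolding inner_def
    by (cases "e \<in> Xs ! i"; rule triple_Block)
      (use that le[OF that(1)] data[OF that] bnd in
        \<open>simp_all add: J_def C_def env_def written_def emit_def mem_of_snoc mem_of_prefix add_ac\<close>)
  have pre: "triple b (I i) (Block [Const 9 0]) 1 (J i 0)" if "i < m" for i
    by (rule triple_Block)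
      (use bnd in \<open>auto simp: I_def J_def C_def env_def written_def\<close>)
  have loop: "triple b (J i 0) (Loop 9 3 inner) (d * (11 + 2) + 2) (J i d)" if "i < m" for i
    by (rule triple_Loop[where I = "J i", OF inner[OF that]]) (auto simp: J_def C_def env_def)
  have post: "triple b (J i d) (Block (emit 8 @ emit 14 @ [Arith Plus 8 8 1])) 5 (I (Suc i))"
    if "i < m" for i
    by (rule triple_Block)
      (use that le[OF that] last[OF that] bnd in
        \<open>auto simp: I_def J_def C_def env_def written_def emit_def mem_of_snoc\<close>)
  have main: "triple b (I 0) rows_code (m * ((1 + ((d * (11 + 2) + 2) + 5)) + 2) + 2) (I m)"
    unfolding rows_code_def inner_def[symmetric]
    by (rule triple_Loop[where I = I, OF triple_Seq[OF pre triple_Seq[OF loop post]]])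
      (auto simp: I_def C_def)
  show ?thesis
    by (rule triple_conseq[OF main]) (auto simp: I_def C_def)
qed


text \<open>The extra element \<open>d\<close> ties every set of \<open>B\<close> to level 2 even if
  the universe is empty. Being in no set of \<open>B\<close>, it never makes a set of
  \<open>A\<close> hit one.\<close>

definition bv_edge_list :: "nat set list \<Rightarrow> nat set list \<Rightarrow> nat \<Rightarrow> nat \<Rightarrow> (nat \<times> nat) list" where
  "bv_edge_list A B n d = spokes n d (3 * Suc d) @ links n n @
     rows (spoke_end n d) (Suc d) (Suc d) (map (insert d) A) 0 n @
     rows (spoke_end n d) (2 * Suc d) (Suc d) B n n"

lemma length_bv_edge_list:
  "length (bv_edge_list A B n d) = 2 * n * Suc d + n + 6 * Suc d"
  by (simp add: bv_edge_list_def)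

definition bv_words :: "nat set list \<Rightarrow> nat set list \<Rightarrow> nat \<Rightarrow> nat \<Rightarrow> nat list" where
  "bv_words A B n d = [bv_order n d, length (bv_edge_list A B n d), 1] @ flat (bv_edge_list A B n d) @
     replicate (bv_order n d) 1 @ [2 * n]"

definition represents :: "nat list \<Rightarrow> nat set list \<Rightarrow> nat set list \<Rightarrow> nat \<Rightarrow> nat \<Rightarrow> bool" where
  "represents xs A B n d \<longleftrightarrow> length xs = 2 + 2 * (n * d) \<and> xs ! 0 = n \<and> xs ! 1 = d \<and>
     length A = n \<and> length B = n \<and> (\<forall>X \<in> set A \<union> set B. X \<subseteq> {..<d}) \<and>
     (\<forall>i<n. \<forall>e<d. xs ! (2 + i * d + e) = (if e \<in> A ! i then 1 else 0) \<and>
        xs ! (2 + n * d + i * d + e) = (if e \<in> B ! i then 1 else 0))"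

lemma row_bound: "i < n \<Longrightarrow> e < d \<Longrightarrow> i * d + e < n * (d::nat)"
  using mult_le_mono1[of "Suc i" n d] by auto

lemma triple_write:
  assumes rep: "represents xs A B n d" and b: "16 * (n * d) + 40 * n + 40 * d + 200 < b"
  shows "triple b (\<lambda>R M. (\<forall>r. R r = 0) \<and> M = mem_of xs) write_code (200 * (Suc n * Suc d))
    (\<lambda>R M. env n d R \<and> M = mem_of (xs @ bv_words A B n d))"
proof -
  let ?w = "spoke_end n d" and ?D = "Suc d"
  note r = rep[unfolded represents_def]
  have sub: "X \<subseteq> {..<d}" if "X \<in> set A \<union> set B" for X using r that by blast
  define ys0 where "ys0 = xs @ [bv_order n d, 2 * n * ?D + n + 6 * ?D, 1]"
  define ys1 where "ys1 = ys0 @ flat (spokes n d (3 * ?D))"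
  define ys2 where "ys2 = ys1 @ flat (links n n)"
  define ys3 where "ys3 = ys2 @ flat (rows ?w ?D ?D (map (insert d) A) 0 n)"
  define ys4 where "ys4 = ys3 @ flat (rows ?w (2 * ?D) ?D B n n)"
  note ys = ys0_def ys1_def ys2_def ys3_def ys4_def
  have len: "length ys0 = 5 + 2 * (n * d)" "length ys1 = 17 + 2 * (n * d) + 12 * d"
    "length ys2 = 17 + 2 * (n * d) + 12 * d + 2 * n" "length ys3 = 17 + 4 * (n * d) + 12 * d + 4 * n"
    "length ys4 = 17 + 6 * (n * d) + 12 * d + 6 * n" "length xs = 2 + 2 * (n * d)"
    using r by (auto simp: ys algebra_simps)
  define PA where "PA R M \<longleftrightarrow> env n d R \<and> R 7 = 2 \<and> R 8 = 0 \<and> R 13 = ?D \<and> R 14 = ?w + d \<and>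
    R 15 = 0 + n \<and> written ys2 R M" for R M
  define PB where "PB R M \<longleftrightarrow> env n d R \<and> R 7 = 2 + n * d \<and> R 8 = n \<and> R 13 = 2 * ?D \<and>
    R 14 = ?w + d + 2 * ?D \<and> R 15 = n + n \<and> written ys3 R M" for R M
  \<comment> \<open>Output is only appended, so the input bits are still found in the prefix
    \<open>xs\<close>.\<close>
  have dataA: "2 + i * d + e < length ys2 \<and>
      ys2 ! (2 + i * d + e) = (if e \<in> map (insert d) A ! i then 1 else 0)" if "i < n" "e < d" for i e
  proof -
    have "2 + i * d + e < length xs" using row_bound[OF that] len(6) by linarith
    then have "2 + i * d + e < length ys2" "ys2 ! (2 + i * d + e) = xs ! (2 + i * d + e)"
      by (simp_all add: ys nth_append)
    then show ?thesis using r that by auto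
  qed
  have dataB: "2 + n * d + i * d + e < length ys3 \<and>
      ys3 ! (2 + n * d + i * d + e) = (if e \<in> B ! i then 1 else 0)" if "i < n" "e < d" for i e
  proof -
    have "2 + n * d + i * d + e < length xs" using row_bound[OF that] len(6) by linarith
    then have "2 + n * d + i * d + e < length ys3"
        "ys3 ! (2 + n * d + i * d + e) = xs ! (2 + n * d + i * d + e)"
      by (simp_all add: ys nth_append)
    then show ?thesis using r that by auto
  qed
  have lastA: "?w + d + (if d \<in> map (insert d) A ! i then 0 else ?D) = ?w + d" if "i < n" for i
    using that r by auto
  have lastB: "?w + d + (if d \<in> B ! i then 0 else 2 * ?D) = ?w + d + 2 * ?D" if "i < n" for i
    using that r sub[of "B ! i"] by (auto dest: nth_mem)
  have t0: "triple b (\<lambda>R M. (\<forall>r. R r = 0) \<and> M = mem_of xs) init_code 31 (\<lambda>R M. env n d R \<and> written ys0 R M)"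
    unfolding ys0_def by (rule triple_init) (use r b in auto)
  have t1: "triple b (\<lambda>R M. env n d R \<and> written ys0 R M) spokes_code (5 + (3 * Suc d * (11 + 2) + 2))
      (\<lambda>R M. env n d R \<and> written ys1 R M)"
    unfolding ys1_def by (rule triple_spokes) (use b in \<open>auto simp: len bv_order_def\<close>)
  have t2: "triple b (\<lambda>R M. env n d R \<and> written ys1 R M) links_code (1 + (n * (5 + 2) + 2))
      (\<lambda>R M. env n d R \<and> written ys2 R M)"
    unfolding ys2_def by (rule triple_links) (use b in \<open>auto simp: len\<close>)
  have t3: "triple b (\<lambda>R M. env n d R \<and> written ys2 R M)
      (Block [Const 8 0, Const 7 2, Arith Plus 13 4 8, Arith Plus 14 5 3, Arith Plus 15 2 8]) 5 PA"
    by (rule triple_Block) (use b in \<open>auto simp: PA_def env_def written_def spoke_end_def\<close>)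
  have t4: "triple b PA rows_code (n * ((1 + ((d * (11 + 2) + 2) + 5)) + 2) + 2)
      (\<lambda>R M. env n d R \<and> R 7 = 2 + n * d \<and> R 8 = 0 + n \<and> R 13 = ?D \<and> R 14 = ?w + d \<and> written ys3 R M)"
    unfolding ys3_def PA_def
    by (rule triple_rows[OF dataA lastA]) (use b in \<open>auto simp: len spoke_end_def algebra_simps\<close>)
  have t5: "triple b (\<lambda>R M. env n d R \<and> R 7 = 2 + n * d \<and> R 8 = 0 + n \<and> R 13 = ?D \<and> R 14 = ?w + d \<and>
      written ys3 R M) (Block [Arith Plus 13 4 4, Arith Plus 14 14 13, Arith Plus 15 2 2]) 3 PB"
    by (rule triple_Block) (use b in \<open>auto simp: PB_def env_def written_def spoke_end_def\<close>)
  have t6: "triple b PB rows_code (n * ((1 + ((d * (11 + 2) + 2) + 5)) + 2) + 2)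
      (\<lambda>R M. env n d R \<and> R 7 = 2 + n * d + n * d \<and> R 8 = n + n \<and> R 13 = 2 * ?D \<and>
        R 14 = ?w + d + 2 * ?D \<and> written ys4 R M)"
    unfolding ys4_def PB_def
    by (rule triple_rows[OF dataB lastB]) (use b in \<open>auto simp: len spoke_end_def algebra_simps\<close>)
  have t7: "triple b (\<lambda>R M. env n d R \<and> R 7 = 2 + n * d + n * d \<and> R 8 = n + n \<and> R 13 = 2 * ?D \<and>
      R 14 = ?w + d + 2 * ?D \<and> written ys4 R M) tail_code (1 + ((bv_order n d * (3 + 2) + 2) + 2))
    (\<lambda>R M. env n d R \<and> written (ys4 @ replicate (bv_order n d) 1 @ [2 * n]) R M)"
    by (rule triple_conseq[OF triple_tail]) (use b in \<open>auto simp: bv_order_def len\<close>)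
  have main: "ys4 @ replicate (bv_order n d) 1 @ [2 * n] = xs @ bv_words A B n d"
    by (simp add: ys bv_words_def length_bv_edge_list bv_edge_list_def)
  have whole: "triple b (\<lambda>R M. (\<forall>r. R r = 0) \<and> M = mem_of xs) write_code
      (31 + ((5 + (3 * Suc d * (11 + 2) + 2)) + ((1 + (n * (5 + 2) + 2)) + (5 +
        ((n * ((1 + ((d * (11 + 2) + 2) + 5)) + 2) + 2) + (3 + 
        ((n * ((1 + ((d * (11 + 2) + 2) + 5)) + 2) + 2) + (1 + ((bv_order n d * (3 + 2) + 2) + 2)))))))))
    (\<lambda>R M. env n d R \<and> written (ys4 @ replicate (bv_order n d) 1 @ [2 * n]) R M)"
    unfolding write_code_def
    by (rule triple_Seq[OF t0 triple_Seq[OF t1 triple_Seq[OF t2 triple_Seq[OF t3 triple_Seq[OF t4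
      triple_Seq[OF t5 triple_Seq[OF t6 t7]]]]]]])
  show ?thesis
    by (rule triple_conseq[OF whole[unfolded main]])
      (simp_all add: written_def, simp add: bv_order_def algebra_simps)
qed

section \<open>The program that checks the answer\<close>

text \<open>Truncated subtraction replaces branches: \<open>1 - (1 - x)\<close> is 0 for
  \<open>x = 0\<close> and 1 otherwise. Register 20 is register 0 of the subroutine, its answer.
  Register 0 holds the verdict: it starts as the test that the answer is below \<open>n\<close> and
  is multiplied by the outcome for each set of \<open>B\<close>.\<close>

definition check_code :: com where
  "check_code =
     Block [Arith Minus 10 2 20, Arith Minus 10 1 10, Arith Minus 0 1 10, Arith Times 8 20 0,
       Arith Times 8 8 3, Arith Plus 8 8 1, Arith Plus 8 8 1, Arith Times 7 2 3, Arith Plus 7 7 1,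
       Arith Plus 7 7 1, Const 9 0] ;;
     Loop 9 2 (
       Block [Const 10 0, Const 11 0, Arith Plus 14 8 10] ;;
       Loop 10 3 (Block [Load 13 14, Load 15 7, Arith Times 13 13 15, Arith Plus 11 11 13,
         Arith Plus 14 14 1, Arith Plus 7 7 1, Arith Plus 10 10 1]) ;;
       Block [Arith Minus 11 1 11, Arith Minus 11 1 11, Arith Times 0 0 11, Arith Plus 9 9 1])"

lemma triple_check:
  assumes rep: "represents xs A B n d" and n: "n \<ge> 1" and b: "2 * (n * d) + n + d + 10 < b"
  shows "triple b
    (\<lambda>R M. R 1 = 1 \<and> R 2 = n \<and> R 3 = d \<and> R 20 = v \<and> (\<forall>a<length xs. M a = xs ! a))
    check_code (50 * (Suc n * Suc d))
    (\<lambda>R M. R 0 = (if v < n \<and> (\<forall>j<n. A ! v \<inter> B ! j \<noteq> {}) then 1 else 0))"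
proof -
  note r = rep[unfolded represents_def]
  \<comment> \<open>An answer that is no set of \<open>A\<close> is replaced by index 0: the verdict
    is 0 anyway, and the reads stay inside the input because \<open>n \<ge> 1\<close>.\<close>
  define u where "u = (if v < n then v else 0)"
  have u: "u < n" using n by (simp add: u_def)
  define C where "C R M \<longleftrightarrow> R 1 = 1 \<and> R 2 = n \<and> R 3 = d \<and> R 8 = 2 + u * d \<and>
    (\<forall>a<length xs. M a = xs ! a)" for R :: "nat \<Rightarrow> nat" and M :: "nat \<Rightarrow> nat"
  define hits where "hits j e \<longleftrightarrow> (\<exists>e'<e. e' \<in> A ! u \<and> e' \<in> B ! j)" for j e
  define ok where "ok j = (if v < n \<and> (\<forall>j'<j. hits j' d) then 1 else 0 :: nat)" for j
  define I where "I j R M \<longleftrightarrow> C R M \<and> R 0 = ok j \<and> R 7 = 2 + n * d + j * d \<and> R 9 = j"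
    for j and R :: "nat \<Rightarrow> nat" and M
  \<comment> \<open>Register 11 counts common elements. Only its positivity matters for the result;
    \<open>R 11 \<le> e\<close> keeps it below the word bound.\<close>
  define J where "J j e R M \<longleftrightarrow> C R M \<and> R 0 = ok j \<and> R 7 = 2 + n * d + j * d + e \<and> R 9 = j \<and>
    R 10 = e \<and> R 14 = 2 + u * d + e \<and> R 11 \<le> e \<and> (0 < R 11 \<longleftrightarrow> hits j e)"
    for j e and R :: "nat \<Rightarrow> nat" and M
  define inner where "inner = Block [Load 13 14, Load 15 7, Arith Times 13 13 15, Arith Plus 11 11 13,
         Arith Plus 14 14 1, Arith Plus 7 7 1, Arith Plus 10 10 1]"
  have hits_Suc: "hits j (Suc e) \<longleftrightarrow> hits j e \<or> e \<in> A ! u \<and> e \<in> B ! j" for j e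
    by (auto simp: hits_def less_Suc_eq)
  have ok_Suc: "ok (Suc j) = (if hits j d then ok j else 0)" for j
    by (auto simp: ok_def less_Suc_eq)
  have ok_le: "ok j \<le> 1" for j by (simp add: ok_def)
  have inner: "triple b (J j e) inner 7 (J j (Suc e))" if "j < n" "e < d" for j e
  proof -
    have *: "u * d + e < n * d" "j * d + e < n * d" "u * d + d \<le> n * d" "j * d + d \<le> n * d"
      using row_bound[OF u that(2)] row_bound[OF that] u that mult_le_mono1[of "Suc u" n d]
        mult_le_mono1[of "Suc j" n d] by auto
    have rd: "xs ! (2 + u * d + e) = (if e \<in> A ! u then 1 else 0)"
      "xs ! (2 + n * d + j * d + e) = (if e \<in> B ! j then 1 else 0)"
      using r u that by auto
    have lt: "2 + u * d + e < length xs" "2 + n * d + j * d + e < length xs"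
      using * r by linarith+
    show ?thesis
      unfolding inner_def
      by (rule triple_Block; cases "e \<in> A ! u"; cases "e \<in> B ! j")
        (use * rd lt b that in \<open>auto simp: J_def C_def hits_Suc\<close>)
  qed
  have pre: "triple b (I j) (Block [Const 10 0, Const 11 0, Arith Plus 14 8 10]) 3 (J j 0)" if "j < n" for j
    by (rule triple_Block)
      (use b that mult_le_mono1[of "Suc u" n d] u in \<open>auto simp: I_def J_def C_def hits_def\<close>)
  have loop: "triple b (J j 0) (Loop 10 3 inner) (d * (7 + 2) + 2) (J j d)" if "j < n" for j
    by (rule triple_Loop[where I = "J j", OF inner[OF that]]) (auto simp: J_def C_def)
  have post: "triple b (J j d) (Block [Arith Minus 11 1 11, Arith Minus 11 1 11, Arith Times 0 0 11,
      Arith Plus 9 9 1]) 4 (I (Suc j))" if "j < n" for j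
  proof (rule triple_Block)
    fix R M :: "nat \<Rightarrow> nat" assume JR: "J j d R M"
    have "1 - (1 - R 11) = (if hits j d then 1 else 0)"
      using JR by (auto simp: J_def)
    then show "wp b [Arith Minus 11 1 11, Arith Minus 11 1 11, Arith Times 0 0 11,
      Arith Plus 9 9 1] (I (Suc j)) R M"
      using JR b that ok_le[of j] by (auto simp: J_def I_def C_def ok_Suc)
  qed simp
  have init: "triple b
    (\<lambda>R M. R 1 = 1 \<and> R 2 = n \<and> R 3 = d \<and> R 20 = v \<and> (\<forall>a<length xs. M a = xs ! a))
    (Block [Arith Minus 10 2 20, Arith Minus 10 1 10, Arith Minus 0 1 10, Arith Times 8 20 0,
       Arith Times 8 8 3, Arith Plus 8 8 1, Arith Plus 8 8 1, Arith Times 7 2 3, Arith Plus 7 7 1,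
       Arith Plus 7 7 1, Const 9 0]) 11 (I 0)"
  proof (rule triple_Block)
    fix R M :: "nat \<Rightarrow> nat" assume *: "R 1 = 1 \<and> R 2 = n \<and> R 3 = d \<and> R 20 = v \<and> (\<forall>a<length xs. M a = xs ! a)"
    have 1: "1 - (1 - (n - v)) = (if v < n then 1 else 0)" by auto
    have 2: "v * (if v < n then 1 else 0) = u" by (simp add: u_def)
    have "u * d + d \<le> n * d" using u mult_le_mono1[of "Suc u" n d] by auto
    then show "wp b [Arith Minus 10 2 20, Arith Minus 10 1 10, Arith Minus 0 1 10, Arith Times 8 20 0,
       Arith Times 8 8 3, Arith Plus 8 8 1, Arith Plus 8 8 1, Arith Times 7 2 3, Arith Plus 7 7 1,
       Arith Plus 7 7 1, Const 9 0] (I 0) R M"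
      using * b u by (cases "v < n") (auto simp: I_def C_def ok_def u_def)
  qed simp
  have main: "triple b (I 0) (Loop 9 2 (Block [Const 10 0, Const 11 0, Arith Plus 14 8 10] ;;
      Loop 10 3 inner ;; Block [Arith Minus 11 1 11, Arith Minus 11 1 11, Arith Times 0 0 11,
      Arith Plus 9 9 1])) (n * ((3 + ((d * (7 + 2) + 2) + 4)) + 2) + 2) (I n)"
    by (rule triple_Loop[where I = I, OF triple_Seq[OF pre triple_Seq[OF loop post]]])
      (auto simp: I_def C_def)
  have "hits j d \<longleftrightarrow> A ! v \<inter> B ! j \<noteq> {}" if "v < n" "j < n" for j
  proof -
    have "A ! v \<subseteq> {..<d}" using r that by (simp add: nth_mem)
    then show ?thesis using that by (auto simp: hits_def u_def)
  qed
  then have "ok n = (if v < n \<and> (\<forall>j<n. A ! v \<inter> B ! j \<noteq> {}) then 1 else 0)"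
    by (auto simp: ok_def)
  then show ?thesis
    unfolding check_code_def inner_def[symmetric]
    by (intro triple_conseq[OF triple_Seq[OF init main]]) (auto simp: I_def algebra_simps)
qed

section \<open>Distances in layered graphs\<close>

lemma gdist_le: "(u, v) \<in> adj E ^^ k \<Longrightarrow> gdist E u v \<le> k"
  by (simp add: gdist_def Least_le)

lemma gdist_walk: "(u, v) \<in> (adj E)\<^sup>* \<Longrightarrow> (u, v) \<in> adj E ^^ gdist E u v"
  unfolding gdist_def by (rule LeastI_ex) (simp add: rtrancl_power)

lemma adj_sym: "(u, v) \<in> adj E \<longleftrightarrow> (v, u) \<in> adj E"
  by (simp add: adj_def insert_commute)

text \<open>\<open>lev\<close> is the distance from the root \<open>s\<close>.\<close>

locale layered_graph =
  fixes V :: "'a set" and E :: "'a set set" and s :: 'a and lev :: "'a \<Rightarrow> nat"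
  assumes fin: "finite V" and s: "s \<in> V" "lev s = 0"
    and edges: "{u, v} \<in> E \<Longrightarrow> u \<in> V \<and> v \<in> V \<and> (lev u = Suc (lev v) \<or> lev v = Suc (lev u))"
    and pairs: "e \<in> E \<Longrightarrow> \<exists>u v. e = {u, v}"
    and parent: "v \<in> V \<Longrightarrow> v \<noteq> s \<Longrightarrow> \<exists>u\<in>V. {v, u} \<in> E \<and> lev v = Suc (lev u)"
begin

lemma walk_to_root: "v \<in> V \<Longrightarrow> (v, s) \<in> adj E ^^ lev v"
proof (induction "lev v" arbitrary: v)
  case 0
  then show ?case using parent[of v] by (cases "v = s") auto
next
  case (Suc k)
  then have "v \<noteq> s" using s by auto
  then obtain u where u: "u \<in> V" "{v, u} \<in> E" "lev v = Suc (lev u)" using parent Suc by blast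
  then have "(u, s) \<in> adj E ^^ k" using Suc by simp
  then have "(v, s) \<in> adj E ^^ Suc k"
    using u(2) by (metis (mono_tags, lifting) adj_def case_prodI mem_Collect_eq relpow_Suc_I2)
  then show ?case using Suc by simp
qed

lemma connected: "connected_graph V E"
proof -
  have "(u, v) \<in> (adj E)\<^sup>*" if "u \<in> V" "v \<in> V" for u v
  proof -
    have "sym ((adj E)\<^sup>*)" by (intro sym_rtrancl symI) (simp add: adj_sym)
    moreover have "(u, s) \<in> (adj E)\<^sup>*" "(v, s) \<in> (adj E)\<^sup>*"
      using walk_to_root that relpow_imp_rtrancl by blast+
    ultimately show ?thesis by (meson rtrancl_trans symD)
  qed
  then show ?thesis using s by (auto simp: connected_graph_def)
qed

lemma simple: "simple_graph V E"
proof -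
  have "\<exists>u v. e = {u, v} \<and> u \<in> V \<and> v \<in> V \<and> u \<noteq> v" if "e \<in> E" for e
    using pairs[OF that] edges that by fastforce
  then show ?thesis using fin by (auto simp: simple_graph_def)
qed

lemma walk_length: "(u, v) \<in> adj E ^^ k \<Longrightarrow> lev u \<le> lev v + k"
proof (induction k arbitrary: u)
  case (Suc k)
  then obtain w where "(u, w) \<in> adj E" "(w, v) \<in> adj E ^^ k" using relpow_Suc_D2 by metis
  then show ?case using Suc.IH[of w] edges[of u w] by (auto simp: adj_def)
qed simp

text \<open>Following parents gives a walk of length \<open>lev v\<close> to the root, and no walk
  is shorter because each edge changes the level by one.\<close>

lemma gdist_root: "v \<in> V \<Longrightarrow> gdist E v s = lev v"
  using walk_to_root gdist_le walk_length gdist_walk relpow_imp_rtrancl s(2)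
  by (metis add_0 le_antisym)

lemma walk: "u \<in> V \<Longrightarrow> v \<in> V \<Longrightarrow> (u, v) \<in> adj E ^^ gdist E u v"
  using connected by (auto simp: connected_graph_def intro: gdist_walk)

text \<open>The territory of \<open>v\<close> for the list \<open>[s, v]\<close>. The inequality is
  strict because \<open>s\<close> comes first and wins ties.\<close>

definition captured :: "'a \<Rightarrow> 'a set" where
  "captured v = {w \<in> V. gdist E w v < lev w}"

lemma finite_captured [simp]: "finite (captured v)"
  using fin by (simp add: captured_def)

lemma max_load_two:
  assumes v: "v \<in> V" and \<pi>: "\<And>w. w \<in> V \<Longrightarrow> \<pi> w = 1"
  shows "max_load V E \<pi> [s, v] = max (real (card V - card (captured v))) (real (card (captured v)))"
proof -
  have t1: "territory V E [s, v] 1 = captured v"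
    by (auto simp: territory_def gdist_list_def captured_def gdist_root)
  have t0: "territory V E [s, v] 0 = V - captured v"
    by (auto simp: territory_def gdist_list_def captured_def gdist_root)
  have sub: "captured v \<subseteq> V" by (auto simp: captured_def)
  have l0: "load V E \<pi> [s, v] 0 = real (card V - card (captured v))"
    using sub \<pi> by (simp add: load_def t0 card_Diff_subset)
  have l1: "load V E \<pi> [s, v] 1 = real (card (captured v))"
  proof -
    have "sum \<pi> (captured v) = sum (\<lambda>_. 1) (captured v)" by (rule sum.cong) (use sub \<pi> in auto)
    then show ?thesis using t1 by (simp add: load_def)
  qed
  have "{..<length [s, v]} = {0, 1}" by auto
  then show ?thesis using l0 l1 by (simp add: max_load_def)
qed

text \<open>If \<open>u\<close> takes at most half of the vertices, its maximum load is what remains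
  for \<open>s\<close>; a vertex \<open>v\<close> capturing fewer would leave \<open>s\<close> an
  even larger load and could not be balanced.\<close>

lemma balanced_captures_most:
  assumes bal: "balanced_vertex V E \<pi> [s] v" and \<pi>: "\<And>w. w \<in> V \<Longrightarrow> \<pi> w = 1"
    and u: "u \<in> V" "u \<noteq> s" "2 * card (captured u) \<le> card V"
  shows "card (captured u) \<le> card (captured v)"
proof -
  have v: "v \<in> V" "max_load V E \<pi> [s, v] \<le> max_load V E \<pi> [s, u]"
    using bal u by (auto simp: balanced_vertex_def)
  show ?thesis
  proof (rule ccontr)
    assume "\<not> ?thesis"
    then show False
      using v(2) max_load_two[OF v(1), of \<pi>] max_load_two[OF u(1), of \<pi>] \<pi> u(3) by (auto simp: max_def split: if_splits)
  qed
qed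

text \<open>A captured vertex is closer to \<open>v\<close> than its level, so at distance at most
  2; the cases are the distances 0, 1 and 2.\<close>

lemma capturedE:
  assumes "w \<in> captured v" "v \<in> V" "lev w \<le> 3"
  obtains "w = v" | "{w, v} \<in> E" "2 \<le> lev w" | x where "{w, x} \<in> E" "{x, v} \<in> E" "lev w = 3"
proof -
  let ?k = "gdist E w v"
  have w: "w \<in> V" "?k < lev w" using assms by (auto simp: captured_def)
  have walk: "(w, v) \<in> adj E ^^ ?k" using walk w assms by blast
  consider "?k = 0" | "?k = 1" | "?k = 2" "lev w = 3" using w assms by linarith
  then show thesis
  proof cases
    case 1
    then show ?thesis using walk that by simp
  next
    case 2
    then show ?thesis using walk that w by (auto simp: adj_def)
  next
    case 3
    then have "(w, v) \<in> adj E O adj E" using walk by (simp add: numeral_2_eq_2)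
    then show ?thesis using that(3) 3 by (auto simp: adj_def)
  qed
qed

lemma capturedI:
  assumes "w \<in> V"
  shows "w = v \<Longrightarrow> 1 \<le> lev w \<Longrightarrow> w \<in> captured v"
    and "{w, v} \<in> E \<Longrightarrow> 2 \<le> lev w \<Longrightarrow> w \<in> captured v"
    and "{w, x} \<in> E \<Longrightarrow> {x, v} \<in> E \<Longrightarrow> 3 \<le> lev w \<Longrightarrow> w \<in> captured v"
proof -
  show "w = v \<Longrightarrow> 1 \<le> lev w \<Longrightarrow> w \<in> captured v"
    using gdist_le[where k = 0, of w v E] assms by (auto simp: captured_def)
  show "{w, v} \<in> E \<Longrightarrow> 2 \<le> lev w \<Longrightarrow> w \<in> captured v"
    using gdist_le[where k = 1, of w v E] assms by (auto simp: captured_def adj_def)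
  show "{w, x} \<in> E \<Longrightarrow> {x, v} \<in> E \<Longrightarrow> 3 \<le> lev w \<Longrightarrow> w \<in> captured v"
  proof -
    assume "{w, x} \<in> E" "{x, v} \<in> E" "3 \<le> lev w"
    moreover from this have "(w, v) \<in> adj E ^^ 2" by (auto simp: adj_def numeral_2_eq_2)
    ultimately show ?thesis using gdist_le[where k = 2, of w v E] assms by (auto simp: captured_def)
  qed
qed

end

section \<open>The reduction\<close>

definition edge_end :: "nat \<Rightarrow> nat \<Rightarrow> nat \<Rightarrow> nat set \<Rightarrow> nat \<Rightarrow> nat" where
  "edge_end n d k X e = spoke_end n d + e + (if e \<in> X then 0 else k)"

definition level :: "nat \<Rightarrow> nat \<Rightarrow> nat \<Rightarrow> nat" where
  "level n d v = (if v = 2 * n then 0 else if v < n then 1 else if v < 2 * n then 3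
     else if v < spoke_end n d then 1 else 2)"

section \<open>Edges and levels of the constructed graph\<close>

lemma set_spokes:
  "set (spokes n d m) = (\<Union>i<m. {(2 * n, 2 * n + 1 + i), (2 * n + 1 + i, spoke_end n d + i)})"
  by (induction m) (auto simp: lessThan_Suc)

lemma set_links: "set (links n m) = (\<lambda>a. (2 * n, a)) ` {..<m}"
  by (auto simp: links_def)

lemma set_row: "set (row w k X v m) = (\<lambda>e. (v, w + e + (if e \<in> X then 0 else k))) ` {..<m}"
  by (auto simp: row_def)

lemma set_rows: "set (rows w k D Xs v m) = (\<Union>i<m. set (row w k (Xs ! i) (v + i) D))"
  by (induction m) (auto simp: lessThan_Suc)

lemma distinct_spokes: "distinct (spokes n d m)"
  by (induction m) (auto simp: set_spokes spoke_end_def)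

lemma distinct_links: "distinct (links n m)"
  by (induction m) (auto simp: set_links)

text \<open>A shift of at least the row length moves the ends of non-elements beyond all unshifted
  ones, so no two elements share an end.\<close>

lemma distinct_row: "m \<le> k \<Longrightarrow> distinct (row w k X v m)"
  by (induction m) (auto simp: set_row split: if_splits)

lemma distinct_rows: "D \<le> k \<Longrightarrow> distinct (rows w k D Xs v m)"
  by (induction m) (auto simp: set_rows set_row distinct_row)

locale reduction =
  fixes A B :: "nat set list" and n d :: nat
  assumes lenA: "length A = n" and lenB: "length B = n" and n: "n \<ge> 1"
    and sub: "\<And>X. X \<in> set A \<union> set B \<Longrightarrow> X \<subseteq> {..<d}"
begin

abbreviation "D \<equiv> Suc d"
abbreviation "N \<equiv> bv_order n d"
abbreviation "V \<equiv> {..<N}"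
abbreviation "endA i \<equiv> edge_end n d D (insert d (A ! i))"
abbreviation "endB i \<equiv> edge_end n d (2 * D) (B ! i)"
abbreviation "lev \<equiv> level n d"

definition "Es = bv_edge_list A B n d"
definition "E = (\<lambda>(u, v). {u, v}) ` set Es"

lemma Es_iff: "(u, v) \<in> set Es \<longleftrightarrow>
    u = 2 * n \<and> (\<exists>i<3 * D. v = 2 * n + 1 + i) \<or>
    (\<exists>i<3 * D. u = 2 * n + 1 + i \<and> v = spoke_end n d + i) \<or>
    u = 2 * n \<and> v < n \<or>
    u < n \<and> (\<exists>e<D. v = endA u e) \<or>
    (\<exists>i<n. u = n + i \<and> (\<exists>e<D. v = endB i e))"
proof -
  have 1: "(u, v) \<in> set (spokes n d (3 * D)) \<longleftrightarrow> u = 2 * n \<and> (\<exists>i<3 * D. v = 2 * n + 1 + i) \<or>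
      (\<exists>i<3 * D. u = 2 * n + 1 + i \<and> v = spoke_end n d + i)"
    unfolding set_spokes by blast
  have 2: "(u, v) \<in> set (links n n) \<longleftrightarrow> u = 2 * n \<and> v < n"
    unfolding set_links by blast
  have 3: "(u, v) \<in> set (rows (spoke_end n d) k D Xs v0 n) \<longleftrightarrow>
      (\<exists>i<n. u = v0 + i \<and> (\<exists>e<D. v = edge_end n d k (Xs ! i) e))" for k Xs v0
    unfolding set_rows set_row edge_end_def by blast
  have 4: "(\<exists>i<n. u = 0 + i \<and> (\<exists>e<D. v = edge_end n d D (map (insert d) A ! i) e)) \<longleftrightarrow>
      u < n \<and> (\<exists>e<D. v = endA u e)"
    using lenA by auto
  show ?thesis
    unfolding Es_def bv_edge_list_def set_append Un_iff 1 2 3 4 by blast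
qed

lemma end_bounds:
  "e < D \<Longrightarrow> spoke_end n d \<le> endA i e \<and> endA i e < N \<and> spoke_end n d \<le> endB i e \<and> endB i e < N"
  by (auto simp: edge_end_def spoke_end_def bv_order_def)

lemma Es_levels:
  assumes "(u, v) \<in> set Es"
  shows "u < N" "v < N" "lev u = 0 \<and> lev v = 1 \<or> lev u = 1 \<and> lev v = 2 \<or> lev u = 3 \<and> lev v = 2"
proof -
  have *: "u < N \<and> v < N \<and> (lev u = 0 \<and> lev v = 1 \<or> lev u = 1 \<and> lev v = 2 \<or> lev u = 3 \<and> lev v = 2)"
    using assms unfolding Es_iff
  proof (elim disjE exE conjE)
    fix e assume "u < n" "e < D" "v = endA u e"
    then show ?thesis using end_bounds[of e u] by (auto simp: level_def bv_order_def spoke_end_def)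
  next
    fix i e assume "i < n" "u = n + i" "e < D" "v = endB i e"
    then show ?thesis using end_bounds[of e i] by (auto simp: level_def bv_order_def spoke_end_def)
  qed (auto simp: level_def bv_order_def spoke_end_def)
  then show "u < N" "v < N" "lev u = 0 \<and> lev v = 1 \<or> lev u = 1 \<and> lev v = 2 \<or> lev u = 3 \<and> lev v = 2"
    by auto
qed

lemma E_iff: "{u, v} \<in> E \<longleftrightarrow> (u, v) \<in> set Es \<or> (v, u) \<in> set Es"
  by (force simp: E_def doubleton_eq_iff)

lemma distinct_edges: "distinct (map (\<lambda>(u, v). {u, v}) Es)"
proof -
  have "distinct Es"
    unfolding Es_def bv_edge_list_def
    by (auto simp: distinct_spokes distinct_links distinct_rows set_spokes set_links set_rows set_row
      spoke_end_def lenA)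
  \<comment> \<open>Listed pairs lead from level 0 to 1, from 1 to 2 or from 3 to 2; a reversed pair
    has none of these forms, so \<open>{u, v}\<close> determines the pair.\<close>
  moreover have "inj_on (\<lambda>(u, v). {u, v}) (set Es)"
  proof (rule inj_onI, clarify)
    fix u v u' v' assume *: "(u, v) \<in> set Es" "(u', v') \<in> set Es" "{u, v} = {u', v'}"
    show "u = u' \<and> v = v'"
      using Es_levels(3)[OF *(1)] Es_levels(3)[OF *(2)] *(3) by (auto simp: doubleton_eq_iff)
  qed
  ultimately show ?thesis by (simp add: distinct_map)
qed

sublocale layered_graph V E "2 * n" lev
proof
  show "finite V" "2 * n \<in> V" "lev (2 * n) = 0" by (auto simp: bv_order_def level_def)
  show "u \<in> V \<and> v \<in> V \<and> (lev u = Suc (lev v) \<or> lev v = Suc (lev u))" if "{u, v} \<in> E" for u v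
    using that Es_levels[of u v] Es_levels[of v u] unfolding E_iff by auto
  show "\<exists>u v. e = {u, v}" if "e \<in> E" for e using that by (auto simp: E_def)
  show "\<exists>u\<in>V. {v, u} \<in> E \<and> lev v = Suc (lev u)" if v: "v \<in> V" "v \<noteq> 2 * n" for v
  proof -
    consider "v < n" | "n \<le> v" "v < 2 * n" | "2 * n < v" "v < spoke_end n d" | "spoke_end n d \<le> v"
      using v by linarith
    then show ?thesis
    proof cases
      case 1
      then show ?thesis
        by (intro bexI[of _ "2 * n"]) (auto simp: E_iff Es_iff level_def bv_order_def)
    next
      case 2
      then obtain i where i: "v = n + i" "i < n" by (metis add_less_cancel_left le_Suc_ex mult_2)
      \<comment> \<open>The end for the extra element \<open>d\<close> serves as the parent; it
        exists even for an empty universe.\<close>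
      then have "(v, endB i d) \<in> set Es" unfolding Es_iff by auto
      then show ?thesis
        using Es_levels[of v "endB i d"] 2 by (intro bexI[of _ "endB i d"]) (auto simp: E_iff level_def)
    next
      case 3
      then have "\<exists>i<3 * D. v = 2 * n + 1 + i"
        by (intro exI[of _ "v - (2 * n + 1)"]) (auto simp: spoke_end_def)
      then have "(2 * n, v) \<in> set Es" unfolding Es_iff by auto
      then show ?thesis
        using 3 by (intro bexI[of _ "2 * n"]) (auto simp: E_iff level_def bv_order_def)
    next
      case 4
      define i where "i = v - spoke_end n d"
      have i: "v = spoke_end n d + i" "i < 3 * D" using 4 v by (auto simp: i_def bv_order_def spoke_end_def)
      then have "(2 * n + 1 + i, v) \<in> set Es" unfolding Es_iff by blast
      then show ?thesis
        using i Es_levels[of "2 * n + 1 + i" v]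
        by (intro bexI[of _ "2 * n + 1 + i"]) (auto simp: E_iff level_def spoke_end_def)
    qed
  qed
qed

text \<open>By the levels, a listed pair whose second component is a set of \<open>A\<close> must
  start at the site; the other orientation is read off \<open>Es_iff\<close>.\<close>

lemma edge_A: "{x, i} \<in> E \<Longrightarrow> i < n \<Longrightarrow> x = 2 * n \<or> x \<in> endA i ` {..<D}"
  unfolding E_iff
proof (elim disjE)
  assume "(x, i) \<in> set Es" "i < n"
  then show ?thesis
    using Es_levels(3)[of x i] by (auto simp: level_def split: if_splits)
next
  assume "(i, x) \<in> set Es" "i < n"
  then show ?thesis by (auto simp: Es_iff)
qed

lemma edge_B: "{x, n + j} \<in> E \<Longrightarrow> j < n \<Longrightarrow> x \<in> endB j ` {..<D}"
  unfolding E_iff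
proof (elim disjE)
  assume "(x, n + j) \<in> set Es" "j < n"
  then show ?thesis
    using Es_levels(3)[of x "n + j"] by (auto simp: level_def split: if_splits)
next
  assume "(n + j, x) \<in> set Es" "j < n"
  then show ?thesis by (auto simp: Es_iff)
qed

lemma edge_spoke: "{x, 2 * n + 1 + i} \<in> E \<Longrightarrow> i < 3 * D \<Longrightarrow> x = 2 * n \<or> x = spoke_end n d + i"
  unfolding E_iff
proof (elim disjE)
  assume "(x, 2 * n + 1 + i) \<in> set Es" "i < 3 * D"
  then show ?thesis
    using Es_levels(3)[of x "2 * n + 1 + i"] by (auto simp: level_def spoke_end_def split: if_splits)
next
  assume "(2 * n + 1 + i, x) \<in> set Es" "i < 3 * D"
  then show ?thesis by (auto simp: Es_iff)
qed

section \<open>How many vertices each candidate captures\<close>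

definition hitting :: "nat \<Rightarrow> bool" where
  "hitting i \<longleftrightarrow> i < n \<and> (\<forall>j<n. A ! i \<inter> B ! j \<noteq> {})"

lemma captured_sub:
  assumes "v \<in> V"
  shows "captured v \<subseteq> insert v ({w. {w, v} \<in> E \<and> lev w = 2} \<union> {n..<2 * n})"
proof
  fix w assume w: "w \<in> captured v"
  have l: "lev w \<le> 3" and l3: "lev w = 3 \<Longrightarrow> w \<in> {n..<2 * n}"
    by (auto simp: level_def split: if_splits)
  show "w \<in> insert v ({w. {w, v} \<in> E \<and> lev w = 2} \<union> {n..<2 * n})"
    using w assms l
  proof (rule capturedE)
    assume "{w, v} \<in> E" "2 \<le> lev w"
    moreover have "lev w = 2 \<or> lev w = 3" using l \<open>2 \<le> lev w\<close> by linarith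
    ultimately show ?thesis using l3 by blast
  qed (use l3 in auto)
qed

lemma lev_hub [simp]: "lev (2 * n) = 0"
  by (simp add: level_def)

lemma nbrs_A: "i < n \<Longrightarrow> {w. {w, i} \<in> E \<and> lev w = 2} \<subseteq> endA i ` {..<D}"
  using edge_A by fastforce

lemma inj_endA: "inj_on (endA i) {..<D}"
  by (rule inj_onI) (auto simp: edge_end_def split: if_splits)

text \<open>The bound counts \<open>i\<close>, its \<open>Suc d\<close> ends and all
  \<open>n\<close> sets of \<open>B\<close>. It is attained exactly if every set of \<open>B\<close>
  is within distance 2, that is, shares an element with \<open>A ! i\<close>.\<close>

lemma card_captured_A:
  assumes "i < n"
  shows "card (captured i) \<le> n + d + 2"
    and "hitting i \<Longrightarrow> card (captured i) = n + d + 2"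
    and "\<not> hitting i \<Longrightarrow> card (captured i) < n + d + 2"
proof -
  let ?U = "insert i (endA i ` {..<D} \<union> {n..<2 * n})"
  have iV: "i \<in> V" using assms by (auto simp: bv_order_def)
  have sub': "captured i \<subseteq> ?U" using captured_sub[OF iV] nbrs_A[OF assms] by blast
  have ge: "2 * n < endA i e" if "e < D" for e
    using end_bounds[OF that, of i] by (auto simp: spoke_end_def)
  then have disj: "i \<notin> endA i ` {..<D} \<union> {n..<2 * n}" "endA i ` {..<D} \<inter> {n..<2 * n} = {}"
    using assms by (force, force)
  have cardU: "card ?U = n + d + 2"
    using disj by (simp add: card_Un_disjoint card_image[OF inj_endA])
  show "card (captured i) \<le> n + d + 2" using card_mono[OF _ sub'] cardU by simp
  show "card (captured i) = n + d + 2" if hit: "hitting i"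
  proof -
    have "?U \<subseteq> captured i"
    proof
      fix w assume "w \<in> ?U"
      then consider "w = i" | e where "e < D" "w = endA i e" | j where "j < n" "w = n + j"
        by (auto simp: le_iff_add)
      then show "w \<in> captured i"
      proof cases
        case 1
        then show ?thesis using capturedI(1)[OF iV] assms by (auto simp: level_def)
      next
        case 2
        then have "(i, w) \<in> set Es" unfolding Es_iff using assms by auto
        moreover have "lev w = 2" using 2 end_bounds[of e i] by (auto simp: level_def spoke_end_def)
        ultimately show ?thesis using capturedI(2)[of w i] Es_levels(2)[of i w] by (auto simp: E_iff)
      next
        case 3
        then obtain e where e: "e \<in> A ! i" "e \<in> B ! j" using hit by (auto simp: hitting_def)
        have "e < d" using sub[of "B ! j"] e 3 lenB by (auto dest: nth_mem)
        \<comment> \<open>Both sets send a common element to the same end in the first copy, which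
          gives a walk of length 2.\<close>
        then have "endA i e = endB j e" "e < D" using e by (auto simp: edge_end_def)
        then have "(i, endB j e) \<in> set Es" "(w, endB j e) \<in> set Es"
          unfolding Es_iff using assms 3 by (metis, auto)
        then show ?thesis
          using capturedI(3)[of w "endB j e" i] Es_levels(1)[of w] 3 by (auto simp: E_iff level_def)
      qed
    qed
    then have "captured i = ?U" using sub' by (rule antisym[rotated])
    then show ?thesis using cardU by simp
  qed
  show "card (captured i) < n + d + 2" if nh: "\<not> hitting i"
  proof -
    obtain j where j: "j < n" "A ! i \<inter> B ! j = {}" using nh assms by (auto simp: hitting_def)
    have "n + j \<notin> captured i"
    proof
      assume c: "n + j \<in> captured i"
      have l: "lev (n + j) = 3" using j by (auto simp: level_def)
      show False
      proof (rule capturedE[OF c iV])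
        assume "n + j = i"
        then show False using assms by simp
      next
        assume "{n + j, i} \<in> E"
        then have "lev (n + j) = 0 \<or> n + j \<in> endA i ` {..<D}" using edge_A[of "n + j" i] assms j(1) by auto
        then show False using l ge j(1) by fastforce
      next
        fix x assume x: "{n + j, x} \<in> E" "{x, i} \<in> E"
        have "x \<in> endB j ` {..<D}" using edge_B[of x j] x(1) j by (simp add: insert_commute)
        then obtain e where e: "e < D" "x = endB j e" by auto
        have "x \<noteq> 2 * n" using e end_bounds[of e j] by (auto simp: spoke_end_def)
        then obtain e' where e': "e' < D" "x = endA i e'" using edge_A[OF x(2) assms] by auto
        \<comment> \<open>\<open>A\<close> uses the first and second copy, \<open>B\<close> the
          first and third. So \<open>x\<close> lies in the first copy and \<open>e = e'\<close> is
          in \<open>B ! j\<close> and in \<open>insert d (A ! i)\<close>; as \<open>d\<close> is not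
          in \<open>B ! j\<close>, it is a common element.\<close>
        have "B ! j \<subseteq> {..<d}" using sub[of "B ! j"] j lenB by auto
        then show False using e e' j(2) by (auto simp: edge_end_def split: if_splits)
      qed (use l in simp)
    qed
    moreover have "n + j \<in> ?U" using j by simp
    ultimately have "captured i \<subset> ?U" using sub' by blast
    then show ?thesis using cardU psubset_card_mono[of ?U "captured i"] by simp
  qed
qed

text \<open>A set of \<open>B\<close> is itself among \<open>{n..<2 * n}\<close>, so only its ends
  are added, at most \<open>Suc d\<close> many. A spoke adds itself and its end, which stays below
  the bound because \<open>d \<ge> 1\<close>; an end of a spoke adds only itself.\<close>

lemma card_captured_other:
  assumes "v \<in> V" "v \<noteq> 2 * n" "n \<le> v" "d \<ge> 1"
  shows "card (captured v) < n + d + 2"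
proof -
  have bound: "card (captured v) \<le> card (S \<union> {n..<2 * n})" if "captured v \<subseteq> S \<union> {n..<2 * n}" "finite S" for S
    using that by (intro card_mono) auto
  have card: "card (S \<union> {n..<2 * n}) \<le> card S + n" for S :: "nat set"
    using card_Un_le[of S "{n..<2 * n}"] by simp
  note cs = captured_sub[OF assms(1)]
  consider "v < 2 * n" | "2 * n < v" "v < spoke_end n d" | "spoke_end n d \<le> v"
    using assms by linarith
  then show ?thesis
  proof cases
    case 1
    then obtain j where j: "v = n + j" "j < n" using assms by (metis add_less_cancel_left le_Suc_ex mult_2)
    then have "captured v \<subseteq> endB j ` {..<D} \<union> {n..<2 * n}" using cs edge_B[of _ j] by auto
    moreover have "card (endB j ` {..<D}) \<le> D" using card_image_le[of "{..<D}" "endB j"] by simp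
    ultimately show ?thesis using bound[of "endB j ` {..<D}"] card[of "endB j ` {..<D}"] by simp
  next
    case 2
    define i where "i = v - (2 * n + 1)"
    have i: "v = 2 * n + 1 + i" "i < 3 * D" using 2 by (auto simp: i_def spoke_end_def)
    have "w = spoke_end n d + i" if "{w, v} \<in> E" "lev w = 2" for w
      using edge_spoke[of w i] that i by auto
    then have "captured v \<subseteq> {v, spoke_end n d + i} \<union> {n..<2 * n}" using cs by blast
    moreover have "card {v, spoke_end n d + i} \<le> 2" by (simp add: card_insert_if)
    ultimately show ?thesis
      using bound[of "{v, spoke_end n d + i}"] card[of "{v, spoke_end n d + i}"] assms(4) by simp
  next
    case 3
    have "lev v = 2" using 3 by (auto simp: level_def spoke_end_def)
    then have "lev w \<noteq> 2" if "{w, v} \<in> E" for w using edges[OF that] by auto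
    then have "captured v \<subseteq> {v} \<union> {n..<2 * n}" using cs by auto
    then show ?thesis using bound[of "{v}"] card[of "{v}"] by simp
  qed
qed

lemma balanced_imp_hitting:
  assumes bal: "balanced_vertex V E (\<lambda>_. 1) [2 * n] v" and ex: "hitting i"
  shows "hitting v"
proof (rule ccontr)
  assume nh: "\<not> hitting v"
  have i: "i < n" "i \<in> V" "i \<noteq> 2 * n" using ex by (auto simp: hitting_def bv_order_def)
  \<comment> \<open>\<open>B\<close> is nonempty, so a hitting set has an element and
    \<open>d\<close> is positive, as the bound for spokes requires.\<close>
  have "A ! i \<inter> B ! 0 \<noteq> {}" using ex n by (auto simp: hitting_def)
  moreover have "A ! i \<subseteq> {..<d}" using sub[of "A ! i"] i lenA by auto
  ultimately have d: "d \<ge> 1" by (cases d) auto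
  have ci: "card (captured i) = n + d + 2" using card_captured_A(2) i ex by blast
  \<comment> \<open>The size condition amounts to
    \<open>2 * (n + d + 2) \<le> 2 * n + 1 + 6 * Suc d\<close>; the spokes and their ends make the
    graph large enough for it.\<close>
  have "card (captured i) \<le> card (captured v)"
    by (rule balanced_captures_most[OF bal]) (use i ci in \<open>auto simp: bv_order_def\<close>)
  moreover have v: "v \<in> V" "v \<noteq> 2 * n" using bal by (auto simp: balanced_vertex_def)
  moreover have "card (captured v) < n + d + 2"
    using card_captured_A(3)[of v] card_captured_other[OF v _ d] nh by (cases "v < n") auto
  ultimately show False using ci by linarith
qed

end

section \<open>From Hitting Set instances to Balanced Vertex instances\<close>

definition bv_of :: "hs_instance \<Rightarrow> bv_instance" where
  "bv_of I = \<lparr>num_vertices = bv_order (hs_size I) (univ_size I),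
     edge_list = bv_edge_list (listA I) (listB I) (hs_size I) (univ_size I),
     cost = (\<lambda>_. 1), sites = [2 * hs_size I]\<rparr>"

lemma bv_encode_bv_of:
  "bv_encode (bv_of I) = bv_words (listA I) (listB I) (hs_size I) (univ_size I)"
  by (simp add: bv_encode_def bv_of_def bv_words_def flat_def map_replicate_const)

lemma hs_reduction: "I \<in> hs_instances c \<Longrightarrow> reduction (listA I) (listB I) (hs_size I) (univ_size I)"
  by (auto simp: hs_instances_def hs_size_def reduction_def)

lemma has_hitting_set_iff:
  assumes "I \<in> hs_instances c"
  shows "has_hitting_set I \<longleftrightarrow>
    (\<exists>i < hs_size I. \<forall>j < hs_size I. listA I ! i \<inter> listB I ! j \<noteq> {})"
proof -
  have "length (listB I) = hs_size I" "length (listA I) = hs_size I"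
    using assms by (auto simp: hs_instances_def hs_size_def)
  then show ?thesis unfolding has_hitting_set_def by (metis in_set_conv_nth)
qed

lemma nth_concat_const:
  assumes "\<And>x. length (f x) = d" "i < length xs" "e < d"
  shows "concat (map f xs) ! (i * d + e) = f (xs ! i) ! e"
  using assms(2)
proof (induction xs arbitrary: i)
  case (Cons x xs)
  show ?case
  proof (cases i)
    case 0
    then show ?thesis using assms(1,3) by (simp add: nth_append)
  next
    case (Suc j)
    then show ?thesis using Cons assms(1)[of x] by (simp add: nth_append)
  qed
qed simp

lemma length_concat_const: "(\<And>x. length (f x) = d) \<Longrightarrow> length (concat (map f xs)) = length xs * d"
  by (induction xs) auto

lemma represents_hs_encode:
  assumes "I \<in> hs_instances c"
  shows "represents (hs_encode I) (listA I) (listB I) (hs_size I) (univ_size I)"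
proof -
  let ?n = "hs_size I" and ?d = "univ_size I" and ?f = "char_vector (univ_size I)"
  have len: "length (?f X) = ?d" for X by (simp add: char_vector_def)
  have AB: "length (listA I) = ?n" "length (listB I) = ?n"
    and sub: "\<forall>X \<in> set (listA I) \<union> set (listB I). X \<subseteq> {..<?d}"
    using assms by (auto simp: hs_instances_def hs_size_def)
  have lens: "length (concat (map ?f (listA I))) = ?n * ?d" "length (concat (map ?f (listB I))) = ?n * ?d"
    using length_concat_const[of ?f, OF len] AB by auto
  have cv: "?f X ! e = (if e \<in> X then 1 else 0)" if "e < ?d" for X e
    using that by (simp add: char_vector_def)
  have "hs_encode I ! (2 + i * ?d + e) = (if e \<in> listA I ! i then 1 else 0)"
    and "hs_encode I ! (2 + ?n * ?d + i * ?d + e) = (if e \<in> listB I ! i then 1 else 0)"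
    if ie: "i < ?n" "e < ?d" for i e
  proof -
    note lt = row_bound[OF ie]
    have "hs_encode I ! (2 + i * ?d + e) = concat (map ?f (listA I)) ! (i * ?d + e)"
      using lt lens by (simp add: hs_encode_def nth_append)
    then show "hs_encode I ! (2 + i * ?d + e) = (if e \<in> listA I ! i then 1 else 0)"
      using nth_concat_const[of ?f, OF len, of i "listA I" e] ie AB cv by simp
    have "hs_encode I ! (2 + (?n * ?d + (i * ?d + e))) = concat (map ?f (listB I)) ! (i * ?d + e)"
      using lens by (simp add: hs_encode_def nth_append)
    then show "hs_encode I ! (2 + ?n * ?d + i * ?d + e) = (if e \<in> listB I ! i then 1 else 0)"
      using nth_concat_const[of ?f, OF len, of i "listB I" e] ie AB cv by (simp add: add.assoc)
  qed
  moreover have "length (hs_encode I) = 2 + 2 * (?n * ?d)"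
    using lens by (simp add: hs_encode_def)
  ultimately show ?thesis
    using AB sub by (auto simp: represents_def hs_encode_def)
qed

text \<open>There are at most \<open>N * (d + 2)\<close> edges. Here \<open>d\<close> is at most
  \<open>c\<close> times the logarithm of \<open>N\<close>, and the 2 is absorbed by twice that
  logarithm since \<open>N \<ge> 2\<close>; hence the constant \<open>c + 2\<close>.\<close>

lemma bv_of_sparse:
  assumes I: "I \<in> hs_instances c" and c: "c \<ge> 0"
  shows "bv_of I \<in> sparse_unit_bv_instances (c + 2)"
proof -
  define n where "n = hs_size I"
  define d where "d = univ_size I"
  interpret reduction "listA I" "listB I" n d
    unfolding n_def d_def by (rule hs_reduction[OF I])
  have edges: "edge_list (bv_of I) = Es" "bv_edges (bv_of I) = E" "bv_vertices (bv_of I) = V"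
    unfolding E_def Es_def by (simp_all add: bv_of_def bv_edges_def bv_vertices_def n_def d_def)
  have rest: "cost (bv_of I) = (\<lambda>_. 1)" "sites (bv_of I) = [2 * n]" "num_vertices (bv_of I) = N"
    by (simp_all add: bv_of_def n_def d_def)
  have "0 \<in> V - {2 * n}" using n by (auto simp: bv_order_def)
  then have "V - {2 * n} \<noteq> {}" by blast
  then have inst: "bv_of I \<in> bv_instances"
    unfolding bv_instances_def mem_Collect_eq edges rest
    using distinct_edges simple connected s(1) by (auto simp: proper_vertex_list_def)
  have "card E \<le> length Es"
    unfolding E_def using card_image_le[of "set Es"] card_length[of Es] by (meson List.finite_set le_trans)
  also have "length Es \<le> N * (d + 2)"
    by (simp add: Es_def length_bv_edge_list bv_order_def algebra_simps)
  finally have card: "real (card E) \<le> real N * (real d + 2)"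
    by (metis (mono_tags) of_nat_add of_nat_le_iff of_nat_mult of_nat_numeral)
  have N2: "2 \<le> N" "n \<le> N" by (auto simp: bv_order_def)
  have "real d \<le> c * log 2 (real n)" using I by (simp add: hs_instances_def n_def d_def)
  also have "\<dots> \<le> c * log 2 (real N)" using n N2 c by (intro mult_left_mono) auto
  finally have "real d \<le> c * log 2 (real N)" .
  moreover have one_le: "1 \<le> log 2 (real N)" using N2 by (subst le_log_iff) auto
  ultimately have "real d + 2 \<le> c * log 2 (real N) + 2 * log 2 (real N)"
    using one_le by simp
  then have "real N * (real d + 2) \<le> real N * ((c + 2) * log 2 (real N))"
    by (intro mult_left_mono) (auto simp: algebra_simps)
  then show ?thesis
    using inst card by (simp add: sparse_unit_bv_instances_def edges rest algebra_simps)
qed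

text \<open>A set that passes the test is its own witness; the converse is
  \<open>balanced_imp_hitting\<close>. So a single test of the output decides the instance.\<close>

lemma bv_correct_imp_hitting:
  assumes I: "I \<in> hs_instances c" and v: "bv_correct (bv_of I) v"
  shows "(v < hs_size I \<and> (\<forall>j < hs_size I. listA I ! v \<inter> listB I ! j \<noteq> {})) \<longleftrightarrow> has_hitting_set I"
proof -
  define n where "n = hs_size I"
  define d where "d = univ_size I"
  interpret reduction "listA I" "listB I" n d
    unfolding n_def d_def by (rule hs_reduction[OF I])
  have "balanced_vertex V E (\<lambda>_. 1) [2 * n] v"
    using v unfolding E_def Es_def
    by (simp add: bv_correct_def bv_of_def bv_edges_def bv_vertices_def n_def d_def)
  then have "hitting v" if "hitting i" for i using balanced_imp_hitting that by blast
  then show ?thesis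
    unfolding has_hitting_set_iff[OF I] n_def[symmetric] hitting_def by blast
qed

section \<open>The algorithm for Hitting Set\<close>

definition hs_program :: "program \<Rightarrow> program" where
  "hs_program p = compile 0 write_code @ sim (clen write_code) p @
     compile (clen write_code + 2 * length p) check_code"

lemma hs_program_computes:
  assumes I: "I \<in> hs_instances c"
    and comp: "computes p b (bv_encode (bv_of I)) t out" and corr: "bv_correct (bv_of I) out"
    and nd: "n = hs_size I" "d = univ_size I"
    and b': "b + 16 * (n * d) + 40 * n + 40 * d + 200 < b'"
  shows "\<exists>t'. t' \<le> 250 * (Suc n * Suc d) + 2 * t \<and>
    computes (hs_program p) b' (hs_encode I) t' (if has_hitting_set I then 1 else 0)"
proof -
  let ?q = "hs_program p" and ?xs = "hs_encode I" and ?bv = "bv_words (listA I) (listB I) n d"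
  let ?l = "clen write_code" and ?L = "length (hs_encode I)"
  note rep = represents_hs_encode[OF I, folded nd]
  have L: "?L = 2 + 2 * (n * d)" using rep by (simp add: represents_def)
  have n: "n \<ge> 1" using I by (simp add: hs_instances_def nd)
  have code: "code_at ?q 0 (compile 0 write_code)" "code_at ?q ?l (sim ?l p)"
    "code_at ?q (?l + 2 * length p) (compile (?l + 2 * length p) check_code)"
    using code_at_embed[of "[]" ?q "[]"] unfolding hs_program_def by (auto simp: code_at_append)
  have words: "x < b'" if "x \<in> set ?xs" for x
    using that b' by (auto simp: hs_encode_def char_vector_def nd split: if_splits)
  have fit0: "fits b' (initial ?xs)" using words b' by (auto simp: fits_def initial_def)
  obtain t1 s1 where 1: "t1 \<le> 200 * (Suc n * Suc d)" "run ?q b' (initial ?xs) t1 s1" "pc s1 = ?l"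
      "env n d (reg s1)" "mem s1 = mem_of (?xs @ ?bv)"
  proof -
    have tr: "triple b' (\<lambda>R M. (\<forall>r. R r = 0) \<and> M = mem_of ?xs) write_code (200 * (Suc n * Suc d))
        (\<lambda>R M. env n d R \<and> M = mem_of (?xs @ ?bv))"
      by (rule triple_write[OF rep]) (use b' in simp)
    have "pc (initial ?xs) = 0" "(\<forall>r. reg (initial ?xs) r = 0) \<and> mem (initial ?xs) = mem_of ?xs"
      by (simp_all add: initial_def mem_of_def)
    then show thesis
      using tr[unfolded triple_def, rule_format, OF code(1) _ fit0] that by auto
  qed
  \<comment> \<open>Registers from 20 on are 0 and the cells from \<open>?L\<close> on hold the
    encoded graph: this is the initial configuration of the subroutine.\<close>
  have "simulates ?l (length p) ?L (reg s1) (mem s1) (initial ?bv) s1"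
    using 1 by (auto simp: simulates_def initial_def env_def reloc_def mem_of_def nth_append)
  moreover have "reg s1 offset_reg = ?L" using 1 L by (simp add: env_def offset_reg_def)
  moreover have "b + ?L \<le> b'" using b' L by simp
  ultimately obtain t2 s2 where 2: "t2 \<le> 2 * t" "run ?q b' s1 t2 s2" "pc s2 = ?l + 2 * length p"
      "reg s2 reloc = out" "\<forall>r<reloc. r \<noteq> addr_reg \<longrightarrow> reg s2 r = reg s1 r" "\<forall>a<?L. mem s2 a = mem s1 a"
    using sim_run[where R = "reg s1" and M = "mem s1", OF comp[unfolded bv_encode_bv_of, folded nd] code(2)
        _ _ run_fits[OF 1(2)]] by blast
  \<comment> \<open>The simulation has kept the low registers and the cells below \<open>?L\<close>,
    so \<open>n\<close>, \<open>d\<close> and the input are still available.\<close>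
  have pre: "reg s2 1 = 1 \<and> reg s2 2 = n \<and> reg s2 3 = d \<and> reg s2 20 = out \<and> (\<forall>a<?L. mem s2 a = ?xs ! a)"
    using 1(4,5) 2(4-6) by (auto simp: env_def reloc_def addr_reg_def mem_of_prefix)
  obtain t3 s3 where 3: "t3 \<le> 50 * (Suc n * Suc d)" "run ?q b' s2 t3 s3"
      "pc s3 = ?l + 2 * length p + clen check_code"
      "reg s3 0 = (if out < n \<and> (\<forall>j<n. listA I ! out \<inter> listB I ! j \<noteq> {}) then 1 else 0)"
  proof -
    have tr: "triple b'
        (\<lambda>R M. R 1 = 1 \<and> R 2 = n \<and> R 3 = d \<and> R 20 = out \<and> (\<forall>a<?L. M a = ?xs ! a))
        check_code (50 * (Suc n * Suc d))
        (\<lambda>R M. R 0 = (if out < n \<and> (\<forall>j<n. listA I ! out \<inter> listB I ! j \<noteq> {}) then 1 else 0))"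
      by (rule triple_check[OF rep n]) (use b' in simp)
    show thesis
      using tr[unfolded triple_def, rule_format, OF code(3) 2(3) run_fits[OF 2(2)] pre] that by blast
  qed
  have "run ?q b' (initial ?xs) (t1 + (t2 + t3)) s3"
    using run_trans[OF 1(2) run_trans[OF 2(2) 3(2)]] .
  moreover have "halted ?q s3" using 3(3) by (simp add: halted_def hs_program_def)
  moreover have "reg s3 0 = (if has_hitting_set I then 1 else 0)"
    using 3(4) bv_correct_imp_hitting[OF I corr] by (simp add: nd)
  ultimately have "computes ?q b' ?xs (t1 + (t2 + t3)) (if has_hitting_set I then 1 else 0)"
    by (auto simp: computes_def run_def config_at_def)
  then show ?thesis using 1(1) 2(1) 3(1) by (intro exI[of _ "t1 + (t2 + t3)"]) auto
qed

section \<open>Estimates for running time and word size\<close>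

text \<open>The finitely many values below the threshold are absorbed into the constant, as the
  power is at least 1 for \<open>m \<ge> 1\<close>; this is where \<open>\<delta> \<le> 2\<close>
  enters.\<close>

lemma bigo_powr_bound:
  assumes T: "T \<in> O(\<lambda>n. real n powr (2 - \<epsilon>))" and \<delta>: "\<delta> \<le> \<epsilon>" "\<delta> \<le> 2"
  obtains K where "K \<ge> 0" "\<And>m. m \<ge> 1 \<Longrightarrow> T m \<le> K * real m powr (2 - \<delta>)"
proof -
  from T obtain C where C: "C > 0" "eventually (\<lambda>n. norm (T n) \<le> C * norm (real n powr (2 - \<epsilon>))) at_top"
    by (elim landau_o.bigE)
  then obtain m0 where m0: "\<And>n. n \<ge> m0 \<Longrightarrow> \<bar>T n\<bar> \<le> C * real n powr (2 - \<epsilon>)"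
    by (auto simp: eventually_at_top_linorder)
  define K where "K = C + (\<Sum>m<m0. \<bar>T m\<bar>)"
  have "T m \<le> K * real m powr (2 - \<delta>)" if "m \<ge> 1" for m
  proof (cases "m < m0")
    case True
    have "T m \<le> \<bar>T m\<bar>" by simp
    also have "\<dots> \<le> (\<Sum>m<m0. \<bar>T m\<bar>)" using True by (intro member_le_sum) auto
    also have "\<dots> \<le> K * 1" using C by (simp add: K_def)
    also have "\<dots> \<le> K * real m powr (2 - \<delta>)"
      using that \<delta> C by (intro mult_left_mono ge_one_powr_ge_zero) (auto simp: K_def intro!: add_nonneg_nonneg sum_nonneg)
    finally show ?thesis .
  next
    case False
    then have "T m \<le> C * real m powr (2 - \<epsilon>)" using m0[of m] by simp
    also have "\<dots> \<le> K * real m powr (2 - \<delta>)"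
      using that \<delta> C by (intro mult_mono powr_mono) (auto simp: K_def intro!: add_nonneg_nonneg sum_nonneg)
    finally show ?thesis .
  qed
  moreover have "K \<ge> 0" using C by (auto simp: K_def intro!: add_nonneg_nonneg sum_nonneg)
  ultimately show thesis using that by blast
qed

text \<open>Bounds the time for writing and checking. The proof uses that \<open>ln n\<close> is at
  most twice the square root of \<open>n\<close>.\<close>

lemma quasilinear_bigo:
  "(\<lambda>n::nat. (real n + 1) * (log 2 (real n) + 1)) \<in> O(\<lambda>n. real n powr (3 / 2))"
proof (intro bigoI eventually_at_top_linorderI)
  fix n :: nat assume n: "1 \<le> n"
  let ?r = "real n powr (1 / 2)"
  have r: "1 \<le> ?r" using n by (simp add: ge_one_powr_ge_zero)
  have ln2: "0 < ln (2::real)" by simp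
  have "ln (real n) \<le> ?r / (1 / 2)" using n by (intro ln_powr_bound) auto
  then have "log 2 (real n) \<le> (2 / ln 2) * ?r"
    using ln2 by (simp add: log_def divide_right_mono)
  then have "log 2 (real n) + 1 \<le> (2 / ln 2 + 1) * ?r" using r by (simp add: algebra_simps)
  then have "(real n + 1) * (log 2 (real n) + 1) \<le> (2 * real n) * ((2 / ln 2 + 1) * ?r)"
    using n by (intro mult_mono) auto
  also have "\<dots> = (2 * (2 / ln 2 + 1)) * (real n * ?r)" by (simp only: mult_ac)
  also have "real n * ?r = real n powr (3 / 2)"
    using n powr_add[of "real n" 1 "1 / 2"] by simp
  finally show "norm ((real n + 1) * (log 2 (real n) + 1)) \<le>
      (2 * (2 / ln 2 + 1)) * norm (real n powr (3 / 2))"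
    using n by simp
qed

lemma hs_univ_le:
  assumes "I \<in> hs_instances c" "c \<ge> 0"
  shows "real (univ_size I) \<le> c * real (hs_size I)"
proof -
  have n: "hs_size I \<ge> 1" using assms by (simp add: hs_instances_def)
  have "log 2 (real (hs_size I)) \<le> real (hs_size I)"
    using n by (simp add: log_le_iff powr_realpow of_nat_less_two_power less_imp_le)
  then show ?thesis
    using assms mult_left_mono[of "log 2 (real (hs_size I))" "real (hs_size I)" c] by (simp add: hs_instances_def)
qed

lemma bv_order_le:
  assumes "I \<in> hs_instances c" "c \<ge> 0"
  shows "real (bv_order (hs_size I) (univ_size I)) \<le> (9 + 6 * c) * real (hs_size I)"
proof -
  have "hs_size I \<ge> 1" using assms by (simp add: hs_instances_def)
  then show ?thesis using hs_univ_le[OF assms] by (simp add: bv_order_def algebra_simps)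
qed

lemma quartic_bound:
  assumes "9 \<le> Y" "n \<le> Y" "d \<le> (Y::nat)"
  shows "16 * (n * d) + 40 * n + 40 * d + 202 \<le> Y ^ 4"
proof -
  obtain Q where Q: "Q = Y * Y" by blast
  have "n * d \<le> Q" "9 * Y \<le> Q" "9 * 9 \<le> Q"
    unfolding Q using assms by (simp_all only: mult_le_mono mult_le_mono1)
  moreover from this have "81 * Q \<le> Q * Q" by (intro mult_le_mono1) simp
  ultimately have "16 * (n * d) + 40 * n + 40 * d + 202 \<le> Q * Q" using assms by linarith
  also have "Q * Q = Y ^ 4" by (simp add: Q power4_eq_xxxx mult.assoc)
  finally show ?thesis .
qed

text \<open>The subroutine may use numbers up to a power of the order of the graph. As that order is
  at most \<open>2 ^ m * n\<close> and \<open>2 \<le> n + 2\<close>, the constant factor turns into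
  a larger exponent.\<close>

lemma hs_word_bound:
  assumes I: "I \<in> hs_instances c" and c: "c \<ge> 0" and n: "n = hs_size I" "d = univ_size I"
    and m: "9 + 6 * c \<le> 2 ^ m"
  shows "(bv_order n d + 2) ^ k + 16 * (n * d) + 40 * n + 40 * d + 200 < (n + 2) ^ ((m + 1) * (k + 4))"
proof -
  let ?Y = "bv_order n d + 2"
  have "real (bv_order n d) \<le> real (2 ^ m * n)"
    using bv_order_le[OF I c] n mult_right_mono[OF m, of "real n"] by simp
  then have N: "bv_order n d \<le> 2 ^ m * n" by (simp only: of_nat_le_iff)
  have "?Y \<le> 2 ^ m * n + 2 ^ m * 2" using N by (intro add_mono) auto
  also have "\<dots> = 2 ^ m * (n + 2)" by simp
  also have "\<dots> \<le> (n + 2) ^ m * (n + 2)" by (intro mult_le_mono1 power_mono) auto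
  finally have Y: "?Y \<le> (n + 2) ^ (m + 1)" by (simp only: power_add power_one_right)
  have 1: "16 * (n * d) + 40 * n + 40 * d + 202 \<le> ?Y ^ 4"
    by (rule quartic_bound) (auto simp: bv_order_def)
  have ge: "?Y ^ k \<ge> 1" by simp
  obtain u where u: "?Y ^ k = Suc u" using ge by (metis Suc_le_D One_nat_def)
  obtain w where w: "?Y ^ 4 = Suc w" using 1 by (metis Suc_le_D add_Suc_right numeral_eq_Suc)
  \<comment> \<open>Holds for all positive factors. The surplus of 202 over 200 outweighs the 1 and
    makes the next bound strict.\<close>
  have "?Y ^ k + ?Y ^ 4 \<le> ?Y ^ k * ?Y ^ 4 + 1" unfolding u w by simp
  then have "?Y ^ k + 16 * (n * d) + 40 * n + 40 * d + 200 < ?Y ^ (k + 4)"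
    using 1 by (simp only: power_add)
  also have "\<dots> \<le> ((n + 2) ^ (m + 1)) ^ (k + 4)" by (rule power_mono[OF Y]) simp
  finally show ?thesis by (simp only: power_mult)
qed

text \<open>The overhead of writing and checking is at most of order \<open>n powr (3 / 2)\<close>;
  \<open>\<delta> \<le> 1 / 2\<close> lets the target bound dominate it.\<close>

lemma hs_from_bv:
  assumes p: "solves_in_O p (sparse_unit_bv_instances (c + 2)) num_vertices bv_encode bv_correct
      (\<lambda>n. real n powr (2 - \<epsilon>))"
    and c: "c \<ge> 1" and \<delta>: "\<delta> \<le> \<epsilon>" "\<delta> \<le> 1 / 2"
  shows "solves_in_O (hs_program p) (hs_instances c) hs_size hs_encode hs_correct
      (\<lambda>n. real n powr (2 - \<delta>))"
proof -
  from p obtain k T where T: "T \<in> O(\<lambda>n. real n powr (2 - \<epsilon>))"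
    and sol: "\<And>J. J \<in> sparse_unit_bv_instances (c + 2) \<Longrightarrow> \<exists>t out. real t \<le> T (num_vertices J) \<and>
        computes p ((num_vertices J + 2) ^ k) (bv_encode J) t out \<and> bv_correct J out"
    unfolding solves_in_O_def by blast
  obtain K where K: "K \<ge> 0" "\<And>m. m \<ge> 1 \<Longrightarrow> T m \<le> K * real m powr (2 - \<delta>)"
    using bigo_powr_bound[OF T] \<delta> by (metis dual_order.trans le_numeral_extra(4) linorder_le_cases
        one_le_numeral order_trans[of \<delta> "1/2" 2] divide_le_eq_numeral1(1) mult_1 numeral_le_iff)
  define a where "a = 9 + 6 * c"
  obtain m :: nat where m: "9 + 6 * c \<le> 2 ^ m"
    using real_arch_pow[of 2 "9 + 6 * c"] by (auto intro: less_imp_le)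
  \<comment> \<open>The first summand pays for writing and checking, the second for the simulated
    run, at most twice as long as the original run on a graph with at most \<open>a * n\<close>
    vertices.\<close>
  define T' where "T' n = (250 * (1 + c)) * ((real n + 1) * (log 2 (real n) + 1)) +
    (2 * K * a powr (2 - \<delta>)) * real n powr (2 - \<delta>)" for n :: nat
  have "(\<lambda>n::nat. (real n + 1) * (log 2 (real n) + 1)) \<in> O(\<lambda>n. real n powr (3 / 2))"
    by (rule quasilinear_bigo)
  also have "(\<lambda>n::nat. real n powr (3 / 2)) \<in> O(\<lambda>n. real n powr (2 - \<delta>))"
    using \<delta> by (intro bigoI[of _ 1] eventually_at_top_linorderI[of 1]) (auto intro: powr_mono)
  finally have "T' \<in> O(\<lambda>n. real n powr (2 - \<delta>))"
    unfolding T'_def by (intro sum_in_bigo) simp_all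
  moreover have "\<exists>t out. real t \<le> T' (hs_size I) \<and>
      computes (hs_program p) ((hs_size I + 2) ^ ((m + 1) * (k + 4))) (hs_encode I) t out \<and>
      hs_correct I out" if I: "I \<in> hs_instances c" for I
  proof -
    define n where "n = hs_size I"
    define d where "d = univ_size I"
    have num: "num_vertices (bv_of I) = bv_order n d" by (simp add: bv_of_def n_def d_def)
    have "bv_of I \<in> sparse_unit_bv_instances (c + 2)" using bv_of_sparse[OF I] c by simp
    then obtain t out where t: "real t \<le> T (bv_order n d)"
        "computes p ((bv_order n d + 2) ^ k) (bv_encode (bv_of I)) t out" "bv_correct (bv_of I) out"
      using sol num by metis
    obtain t' where t': "t' \<le> 250 * (Suc n * Suc d) + 2 * t"
        "computes (hs_program p) ((n + 2) ^ ((m + 1) * (k + 4))) (hs_encode I) t'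
          (if has_hitting_set I then 1 else 0)"
      using hs_program_computes[OF I t(2,3) n_def d_def hs_word_bound[OF I _ n_def d_def m]] c by auto
    have n1: "n \<ge> 1" and d: "real d \<le> c * log 2 (real n)" using I by (auto simp: hs_instances_def n_def d_def)
    have log_nonneg: "0 \<le> log 2 (real n)" using n1 by simp
    have "real (Suc n * Suc d) = (real n + 1) * (real d + 1)" by (simp add: algebra_simps)
    also have "real d + 1 \<le> (1 + c) * (log 2 (real n) + 1)"
      using d c log_nonneg by (simp add: algebra_simps)
    finally have 1: "real (Suc n * Suc d) \<le> (1 + c) * ((real n + 1) * (log 2 (real n) + 1))"
      by (simp add: mult_left_mono mult.left_commute)
    have "real t \<le> K * real (bv_order n d) powr (2 - \<delta>)"
      using t(1) K(2)[of "bv_order n d"] by (simp add: bv_order_def)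
    also have "\<dots> \<le> K * (a * real n) powr (2 - \<delta>)"
      using bv_order_le[OF I] c \<delta> K(1) by (intro mult_left_mono powr_mono2) (auto simp: a_def n_def d_def)
    also have "\<dots> = K * a powr (2 - \<delta>) * real n powr (2 - \<delta>)"
      using c by (simp add: powr_mult a_def)
    finally have 2: "real t \<le> K * a powr (2 - \<delta>) * real n powr (2 - \<delta>)" .
    have "real t' \<le> 250 * real (Suc n * Suc d) + 2 * real t"
      using t'(1) by (metis (mono_tags, lifting) of_nat_add of_nat_le_iff of_nat_mult of_nat_numeral)
    also have "\<dots> \<le> T' n" using 1 2 unfolding T'_def by linarith
    finally show ?thesis using t'(2) by (auto simp: hs_correct_def n_def)
  qed
  ultimately show ?thesis unfolding solves_in_O_def by blast
qed

theorem mainTheorem3: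
  assumes "Hitting_Set_Conjecture"
  shows "\<not> (\<exists>\<epsilon>::real. \<epsilon> > 0 \<and> (\<forall>c::real. c \<ge> 1 \<longrightarrow>
            (\<exists>p. solves_in_O p (sparse_unit_bv_instances c) num_vertices bv_encode bv_correct
                   (\<lambda>n. real n powr (2 - \<epsilon>)))))"
proof
  assume "\<exists>\<epsilon>::real. \<epsilon> > 0 \<and> (\<forall>c::real. c \<ge> 1 \<longrightarrow>
            (\<exists>p. solves_in_O p (sparse_unit_bv_instances c) num_vertices bv_encode bv_correct
                   (\<lambda>n. real n powr (2 - \<epsilon>))))"
  then obtain \<epsilon> :: real where \<epsilon>: "\<epsilon> > 0"
    and bv: "\<And>c. c \<ge> 1 \<Longrightarrow> \<exists>p. solves_in_O p (sparse_unit_bv_instances c) num_vertices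
      bv_encode bv_correct (\<lambda>n. real n powr (2 - \<epsilon>))" by blast
  \<comment> \<open>The saving in the exponent has to be the same for all \<open>c\<close>; cutting
    \<open>\<epsilon>\<close> off at 1/2 does not depend on \<open>c\<close>.\<close>
  have "\<exists>q. solves_in_O q (hs_instances c) hs_size hs_encode hs_correct
      (\<lambda>n. real n powr (2 - min \<epsilon> (1 / 2)))" if c: "c \<ge> 1" for c
    using bv[of "c + 2"] c hs_from_bv[of _ c \<epsilon> "min \<epsilon> (1 / 2)"] by fastforce
  moreover have "min \<epsilon> (1 / 2) > 0" using \<epsilon> by simp
  ultimately show False using assms unfolding Hitting_Set_Conjecture_def by blast
qed

end
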